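(* Let $p\in(0,\infty)$ with $p\neq2$, let $\mathfrak N$ be a $\mathrm{II}_1$ factor, and let $\psi$ be a surjective $L^p$-isometry on $\mathscr U(\mathfrak N)$ such that $\psi(e^{i\theta}U)=e^{i\theta}U$ for every self-adjoint unitary $U\in\mathfrak N$ and every $\theta\in\mathbb R$. Then $\psi(e^{i\theta}UV)=e^{i\theta}UV$ for all self-adjoint unitaries $U,V\in\mathfrak N$ and every $\theta\in\mathbb R$.
   Context: $\mathscr U(\mathfrak N)$ is the unitary group of $\mathfrak N$; with $\tau$ the tracial state of $\mathfrak N$, $\|A\|_p:=\tau(|A|^p)^{1/p}$. A map $\psi:\mathscr U(\mathfrak N)\to\mathscr U(\mathfrak N)$ is an $L^p$-isometry if $\|U-V\|_p=\|\psi(U)-\psi(V)\|_p$ for all $U,V\in\mathscr U(\mathfrak N)$. *)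

theory Defs
  imports "HOL-Analysis.Analysis" "HOL-Computational_Algebra.Polynomial"
begin

section \<open>Complex Hilbert spaces\<close>

class scaleC =
  fixes scaleC :: "complex \<Rightarrow> 'a \<Rightarrow> 'a"  (infixr \<open>*\<^sub>C\<close> 75)

text \<open>The inner product is conjugate-linear in the first argument. Definiteness and
  completeness come from the superclass \<^class>\<open>banach\<close> through \<open>norm_eq_sqrt_cinner\<close>.\<close>

class chilbert_space = banach + scaleC +
  fixes cinner :: "'a \<Rightarrow> 'a \<Rightarrow> complex"
  assumes scaleC_add_right: "c *\<^sub>C (x + y) = c *\<^sub>C x + c *\<^sub>C y"
    and scaleC_add_left: "(c + d) *\<^sub>C x = c *\<^sub>C x + d *\<^sub>C x"
    and scaleC_scaleC: "c *\<^sub>C d *\<^sub>C x = (c * d) *\<^sub>C x"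
    and scaleR_scaleC: "r *\<^sub>R x = complex_of_real r *\<^sub>C x"
    and cinner_commute: "cinner x y = cnj (cinner y x)"
    and cinner_add_right: "cinner x (y + z) = cinner x y + cinner x z"
    and cinner_scaleC_right: "cinner x (c *\<^sub>C y) = c * cinner x y"
    and cinner_self_nonneg: "cinner x x \<in> \<real>\<^sub>\<ge>\<^sub>0"
    and norm_eq_sqrt_cinner: "norm x = sqrt (Re (cinner x x))"

lemma norm_scaleC:
  fixes x :: "'a :: chilbert_space"
  shows "norm (c *\<^sub>C x) = cmod c * norm x"
proof -
  have "cinner (c *\<^sub>C x) (c *\<^sub>C x) = c * cnj (c * cinner x x)"
    by (metis cinner_commute cinner_scaleC_right)
  also have "\<dots> = complex_of_real ((cmod c)\<^sup>2) * cinner x x"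
    by (metis cinner_commute complex_cnj_mult complex_norm_square mult.assoc)
  finally have "Re (cinner (c *\<^sub>C x) (c *\<^sub>C x)) = (cmod c)\<^sup>2 * Re (cinner x x)"
    by simp
  then show ?thesis
    by (simp add: norm_eq_sqrt_cinner real_sqrt_mult)
qed

lemma bounded_linear_scaleC:
  "bounded_linear (\<lambda>x :: 'a :: chilbert_space. c *\<^sub>C x)"
proof (rule bounded_linear_intro[where K = "cmod c"])
  show "c *\<^sub>C (r *\<^sub>R x) = r *\<^sub>R (c *\<^sub>C x)" for r and x :: 'a
    by (simp add: scaleR_scaleC scaleC_scaleC mult.commute)
qed (auto simp: scaleC_add_right norm_scaleC)

section \<open>Bounded operators\<close>

text \<open>Operators are represented by \<^typ>\<open>'a \<Rightarrow>\<^sub>L 'a\<close>, whose members are bounded and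
  \<^emph>\<open>real\<close>-linear and whose norm is the operator norm; \<open>bounded_ops\<close> is the algebra of
  bounded \<^emph>\<open>complex\<close>-linear operators. Products are compositions \<open>o\<^sub>L\<close>.\<close>

instantiation blinfun :: (real_normed_vector, chilbert_space) scaleC
begin

lift_definition scaleC_blinfun :: "complex \<Rightarrow> 'a \<Rightarrow>\<^sub>L 'b \<Rightarrow> 'a \<Rightarrow>\<^sub>L 'b"
  is "\<lambda>c f x. c *\<^sub>C f x"
  by (rule bounded_linear_compose[OF bounded_linear_scaleC])

instance ..

end

type_synonym 'h operator = "'h \<Rightarrow>\<^sub>L 'h"

definition bounded_ops :: "('h :: chilbert_space) operator set" where
  "bounded_ops = {A. \<forall>c x. blinfun_apply A (c *\<^sub>C x) = c *\<^sub>C blinfun_apply A x}"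

definition adj :: "('h :: chilbert_space) operator \<Rightarrow> 'h operator" where
  "adj A = (THE B. B \<in> bounded_ops \<and>
     (\<forall>x y. cinner (blinfun_apply A x) y = cinner x (blinfun_apply B y)))"

definition positive_op :: "('h :: chilbert_space) operator \<Rightarrow> bool" where
  "positive_op A \<longleftrightarrow> A \<in> bounded_ops \<and> (\<forall>x. cinner x (blinfun_apply A x) \<in> \<real>\<^sub>\<ge>\<^sub>0)"

definition op_le :: "('h :: chilbert_space) operator \<Rightarrow> 'h operator \<Rightarrow> bool"  (infix \<open>\<preceq>\<close> 50) where
  "A \<preceq> B \<longleftrightarrow> positive_op (B - A)"

definition selfadjoint_op :: "('h :: chilbert_space) operator \<Rightarrow> bool" where
  "selfadjoint_op A \<longleftrightarrow> A \<in> bounded_ops \<and> adj A = A"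

definition unitary_op :: "('h :: chilbert_space) operator \<Rightarrow> bool" where
  "unitary_op U \<longleftrightarrow> U \<in> bounded_ops \<and>
     adj U o\<^sub>L U = id_blinfun \<and> U o\<^sub>L adj U = id_blinfun"

definition projection_op :: "('h :: chilbert_space) operator \<Rightarrow> bool" where
  "projection_op E \<longleftrightarrow> selfadjoint_op E \<and> E o\<^sub>L E = E"

section \<open>The operators |A| and |A| to the power p\<close>

definition abs_op :: "('h :: chilbert_space) operator \<Rightarrow> 'h operator" where
  "abs_op A = (THE S. positive_op S \<and> S o\<^sub>L S = adj A o\<^sub>L A)"

definition poly_op :: "real poly \<Rightarrow> ('h :: chilbert_space) operator \<Rightarrow> 'h operator" where
  "poly_op q A = (\<Sum>i\<le>degree q. coeff q i *\<^sub>R (((o\<^sub>L) A ^^ i) id_blinfun))"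

text \<open>Continuous functional calculus for a positive operator \<open>A\<close> and \<open>f\<close> continuous on
  \<open>[0, \<parallel>A\<parallel>]\<close>, an interval containing the spectrum of \<open>A\<close>: \<open>f(A)\<close> is the norm limit
  of \<open>q\<^sub>n(A)\<close> for every sequence of polynomials \<open>q\<^sub>n\<close> converging to \<open>f\<close> uniformly on that
  interval.\<close>

definition fun_calc :: "(real \<Rightarrow> real) \<Rightarrow> ('h :: chilbert_space) operator \<Rightarrow> 'h operator" where
  "fun_calc f A = (THE B. \<forall>q :: nat \<Rightarrow> real poly.
     uniform_limit {0..norm A} (\<lambda>n. poly (q n)) f sequentially \<longrightarrow>
     (\<lambda>n. poly_op (q n) A) \<longlonglongrightarrow> B)"

text \<open>For \<open>p > 0\<close>, \<open>t powr p\<close> is continuous on \<open>[0, \<infinity>)\<close> since \<open>0 powr p = 0\<close>.\<close>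

definition abs_powr_op :: "('h :: chilbert_space) operator \<Rightarrow> real \<Rightarrow> 'h operator" where
  "abs_powr_op A p = fun_calc (\<lambda>t. t powr p) (abs_op A)"

section \<open>Von Neumann algebras and factors of type II 1\<close>

definition commutant :: "('h :: chilbert_space) operator set \<Rightarrow> 'h operator set" where
  "commutant S = {B \<in> bounded_ops. \<forall>A\<in>S. A o\<^sub>L B = B o\<^sub>L A}"

definition von_neumann_algebra :: "('h :: chilbert_space) operator set \<Rightarrow> bool" where
  "von_neumann_algebra N \<longleftrightarrow>
     N \<subseteq> bounded_ops \<and> (\<forall>A\<in>N. adj A \<in> N) \<and> commutant (commutant N) = N"

text \<open>The zero algebra, acting on the zero space, is not a factor.\<close>

definition factor :: "('h :: chilbert_space) operator set \<Rightarrow> bool" where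
  "factor N \<longleftrightarrow> von_neumann_algebra N \<and> (id_blinfun :: 'h operator) \<noteq> 0 \<and>
     N \<inter> commutant N = range (\<lambda>c. c *\<^sub>C id_blinfun)"

definition mvn_equivalent ::
    "('h :: chilbert_space) operator set \<Rightarrow> 'h operator \<Rightarrow> 'h operator \<Rightarrow> bool" where
  "mvn_equivalent N E F \<longleftrightarrow> (\<exists>V\<in>N. adj V o\<^sub>L V = E \<and> V o\<^sub>L adj V = F)"

definition finite_projection ::
    "('h :: chilbert_space) operator set \<Rightarrow> 'h operator \<Rightarrow> bool" where
  "finite_projection N E \<longleftrightarrow> E \<in> N \<and> projection_op E \<and>
     (\<forall>F\<in>N. projection_op F \<and> F \<preceq> E \<and> mvn_equivalent N E F \<longrightarrow> F = E)"

definition abelian_projection ::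
    "('h :: chilbert_space) operator set \<Rightarrow> 'h operator \<Rightarrow> bool" where
  "abelian_projection N E \<longleftrightarrow> E \<in> N \<and> projection_op E \<and>
     (\<forall>A\<in>N. \<forall>B\<in>N. (E o\<^sub>L A o\<^sub>L E) o\<^sub>L (E o\<^sub>L B o\<^sub>L E) = (E o\<^sub>L B o\<^sub>L E) o\<^sub>L (E o\<^sub>L A o\<^sub>L E))"

definition II1_factor :: "('h :: chilbert_space) operator set \<Rightarrow> bool" where
  "II1_factor N \<longleftrightarrow> factor N \<and> finite_projection N id_blinfun \<and>
     (\<forall>E. abelian_projection N E \<longrightarrow> E = 0)"

section \<open>The trace and its p-norms\<close>

definition tracial_state ::
    "('h :: chilbert_space) operator set \<Rightarrow> ('h operator \<Rightarrow> complex) \<Rightarrow> bool" where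
  "tracial_state N \<tau> \<longleftrightarrow>
     (\<forall>A\<in>N. \<forall>B\<in>N. \<tau> (A + B) = \<tau> A + \<tau> B) \<and>
     (\<forall>c. \<forall>A\<in>N. \<tau> (c *\<^sub>C A) = c * \<tau> A) \<and>
     (\<forall>A\<in>N. positive_op A \<longrightarrow> \<tau> A \<in> \<real>\<^sub>\<ge>\<^sub>0) \<and>
     \<tau> id_blinfun = 1 \<and>
     (\<forall>A\<in>N. \<forall>B\<in>N. \<tau> (A o\<^sub>L B) = \<tau> (B o\<^sub>L A))"

definition faithful_on ::
    "('h :: chilbert_space) operator set \<Rightarrow> ('h operator \<Rightarrow> complex) \<Rightarrow> bool" where
  "faithful_on N \<tau> \<longleftrightarrow> (\<forall>A\<in>N. positive_op A \<and> \<tau> A = 0 \<longrightarrow> A = 0)"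

text \<open>Normality: \<open>\<tau>\<close> preserves suprema of bounded upward directed families of positive
  operators.\<close>

definition normal_on ::
    "('h :: chilbert_space) operator set \<Rightarrow> ('h operator \<Rightarrow> complex) \<Rightarrow> bool" where
  "normal_on N \<tau> \<longleftrightarrow> (\<forall>D A.
     D \<subseteq> N \<and> D \<noteq> {} \<and> (\<forall>B\<in>D. positive_op B) \<and>
     (\<forall>B\<in>D. \<forall>C\<in>D. \<exists>E\<in>D. B \<preceq> E \<and> C \<preceq> E) \<and>
     A \<in> N \<and> (\<forall>B\<in>D. B \<preceq> A) \<and> (\<forall>C\<in>N. (\<forall>B\<in>D. B \<preceq> C) \<longrightarrow> A \<preceq> C)
     \<longrightarrow> Re (\<tau> A) = (SUP B\<in>D. Re (\<tau> B)))"

text \<open>A factor of type II 1 has exactly one tracial state, and it is faithful and normal;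
  the following predicate singles it out.\<close>

definition canonical_trace ::
    "('h :: chilbert_space) operator set \<Rightarrow> ('h operator \<Rightarrow> complex) \<Rightarrow> bool" where
  "canonical_trace N \<tau> \<longleftrightarrow> tracial_state N \<tau> \<and> faithful_on N \<tau> \<and> normal_on N \<tau>"

definition trace_norm ::
    "(('h :: chilbert_space) operator \<Rightarrow> complex) \<Rightarrow> real \<Rightarrow> 'h operator \<Rightarrow> real" where
  "trace_norm \<tau> p A = Re (\<tau> (abs_powr_op A p)) powr (1 / p)"

definition unitary_group :: "('h :: chilbert_space) operator set \<Rightarrow> 'h operator set" where
  "unitary_group N = {U \<in> N. unitary_op U}"

definition Lp_isometry ::
    "('h :: chilbert_space) operator set \<Rightarrow> ('h operator \<Rightarrow> complex) \<Rightarrow> real \<Rightarrow>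
     ('h operator \<Rightarrow> 'h operator) \<Rightarrow> bool" where
  "Lp_isometry N \<tau> p \<psi> \<longleftrightarrow>
     (\<forall>U\<in>unitary_group N. \<psi> U \<in> unitary_group N) \<and>
     (\<forall>U\<in>unitary_group N. \<forall>V\<in>unitary_group N.
        trace_norm \<tau> p (U - V) = trace_norm \<tau> p (\<psi> U - \<psi> V))"

end

theory Submission
  imports Defs "HOL-Computational_Algebra.Fundamental_Theorem_Algebra"
begin

text \<open>For unitaries \<open>A\<close>, \<open>S\<close> with \<open>S\<close> self-adjoint, \<open>|A - e\<^sup>i\<^sup>\<phi> S|\<^sup>2 = 2 - 2 Re (e\<^sup>-\<^sup>i\<^sup>\<phi> S A)\<close>, so
  \<open>\<phi> \<mapsto> \<tau>(|A - e\<^sup>i\<^sup>\<phi> S|\<^sup>p)\<close> is the convolution of the spectral distribution of the unitary \<open>S A\<close>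
  with \<open>t \<mapsto> |1 - e\<^sup>i\<^sup>t|\<^sup>p\<close>. The first Fourier coefficient of the latter is nonzero for every
  \<open>p > 0\<close>, so the distances from \<open>A\<close> to all multiples \<open>e\<^sup>i\<^sup>\<phi> S\<close> determine \<open>\<tau>(S A)\<close>.
  Applied to \<open>A = e\<^sup>i\<^sup>\<theta> U V\<close> and \<open>B = \<psi>(A)\<close>, which have the same distances to these fixed points
  of \<open>\<psi>\<close>, this gives \<open>\<tau>(S (A - B)) = 0\<close> for all symmetries \<open>S\<close>, hence
  \<open>\<tau>(E (A - B)) = 0\<close> for all projections \<open>E\<close>, and faithfulness of the trace forces \<open>A = B\<close>.\<close>

section \<open>Inner product\<close>

lemma cinner_add_left: "cinner (x + y) z = cinner x z + cinner (y :: 'a :: chilbert_space) z"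
  by (metis cinner_add_right cinner_commute complex_cnj_add)

lemma cinner_scaleC_left: "cinner (c *\<^sub>C x) y = cnj c * cinner x (y :: 'a :: chilbert_space)"
  by (metis cinner_commute cinner_scaleC_right complex_cnj_mult)

lemma scaleC_one [simp]: "1 *\<^sub>C x = (x :: 'a :: chilbert_space)"
  by (metis of_real_1 scaleR_one scaleR_scaleC)

lemma scaleC_zero_left [simp]: "0 *\<^sub>C x = (0 :: 'a :: chilbert_space)"
  by (metis of_real_0 scaleR_zero_left scaleR_scaleC)

lemma scaleC_minus1: "(-1) *\<^sub>C x = - (x :: 'a :: chilbert_space)"
  by (metis of_real_1 of_real_minus scaleR_minus1_left scaleR_scaleC)

lemma scaleC_zero_right [simp]: "c *\<^sub>C (0 :: 'a :: chilbert_space) = 0"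
  by (metis mult_zero_right scaleC_scaleC scaleC_zero_left)

lemma scaleC_minus_right [simp]: "c *\<^sub>C (- x) = - (c *\<^sub>C (x :: 'a :: chilbert_space))"
  by (metis scaleC_minus1 scaleC_scaleC mult.commute)

lemma scaleC_minus_left [simp]: "(- c) *\<^sub>C x = - (c *\<^sub>C (x :: 'a :: chilbert_space))"
  by (metis scaleC_minus1 scaleC_scaleC mult_minus1)

lemma scaleC_diff_right: "c *\<^sub>C (x - y) = c *\<^sub>C x - c *\<^sub>C (y :: 'a :: chilbert_space)"
  using scaleC_add_right[of c x "- y"] by simp

lemma cinner_minus_right [simp]: "cinner x (- y) = - cinner x (y :: 'a :: chilbert_space)"
  by (metis cinner_scaleC_right mult_minus1 scaleC_minus1)

lemma cinner_minus_left [simp]: "cinner (- x) y = - cinner x (y :: 'a :: chilbert_space)"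
  by (metis cinner_commute cinner_minus_right complex_cnj_minus)

lemma cinner_diff_right: "cinner x (y - z) = cinner x y - cinner x (z :: 'a :: chilbert_space)"
  using cinner_add_right[of x y "- z"] by simp

lemma cinner_diff_left: "cinner (x - y) z = cinner x z - cinner y (z :: 'a :: chilbert_space)"
  using cinner_add_left[of x "- y" z] by simp

lemma cinner_zero_right [simp]: "cinner x (0 :: 'a :: chilbert_space) = 0"
  using cinner_diff_right[of x 0 0] by simp

lemma cinner_zero_left [simp]: "cinner 0 (x :: 'a :: chilbert_space) = 0"
  using cinner_diff_left[of 0 0 x] by simp

lemma cinner_scaleR_right: "cinner x (r *\<^sub>R y) = of_real r * cinner x (y :: 'a :: chilbert_space)"
  by (simp add: cinner_scaleC_right scaleR_scaleC)

lemma cinner_scaleR_left: "cinner (r *\<^sub>R x) y = of_real r * cinner x (y :: 'a :: chilbert_space)"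
  by (simp add: cinner_scaleC_left scaleR_scaleC)

lemmas cinner_linear =
  cinner_add_left cinner_add_right cinner_diff_left cinner_diff_right
  cinner_scaleC_left cinner_scaleC_right cinner_scaleR_left cinner_scaleR_right

lemma cinner_self: "cinner x x = of_real ((norm (x :: 'a :: chilbert_space))\<^sup>2)"
proof -
  obtain r where r: "r \<ge> 0" "cinner x x = of_real r"
    using cinner_self_nonneg[of x] by (auto elim: nonneg_Reals_cases)
  then have "norm x = sqrt r" by (simp add: norm_eq_sqrt_cinner)
  with r show ?thesis by simp
qed

lemma norm_diff_squared:
  "(norm (x - y :: 'a :: chilbert_space))\<^sup>2 = (norm x)\<^sup>2 - 2 * Re (cinner x y) + (norm y)\<^sup>2"
proof -
  have "cinner (x - y) (x - y) = cinner x x - (cinner x y + cnj (cinner x y)) + cinner y y"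
    by (simp add: cinner_linear cinner_commute[of y x])
  then have "complex_of_real ((norm (x - y))\<^sup>2)
      = of_real ((norm x)\<^sup>2 - 2 * Re (cinner x y) + (norm y)\<^sup>2)"
    by (simp add: cinner_self complex_add_cnj del: of_real_power)
  then show ?thesis
    by (simp only: of_real_eq_iff)
qed

lemma parallelogram:
  "(norm (x + y :: 'a :: chilbert_space))\<^sup>2 + (norm (x - y))\<^sup>2 = 2 * (norm x)\<^sup>2 + 2 * (norm y)\<^sup>2"
  using norm_diff_squared[of x y] norm_diff_squared[of x "- y"] by simp

lemma cinner_cauchy_schwarz:
  "cmod (cinner x y) \<le> norm x * norm (y :: 'a :: chilbert_space)"
proof (cases "y = 0")
  case False
  define c where "c = cinner y x / of_real ((norm y)\<^sup>2)"
  have n: "(norm y)\<^sup>2 > 0" using False by simp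
  have e: "cinner x (c *\<^sub>C y) = of_real ((cmod (cinner x y))\<^sup>2 / (norm y)\<^sup>2)"
    by (simp add: c_def cinner_scaleC_right cinner_commute[of y x] 
          complex_norm_square mult.commute del: of_real_power)
  have "cmod c = cmod (cinner x y) / (norm y)\<^sup>2"
    by (simp add: c_def norm_divide norm_power cinner_commute[of y x])
  then have "(norm (c *\<^sub>C y))\<^sup>2 = (cmod (cinner x y))\<^sup>2 / (norm y)\<^sup>2"
    using n by (simp add: norm_scaleC power_mult_distrib power_divide) (simp add: power2_eq_square power4_eq_xxxx)
  moreover have "0 \<le> (norm (x - c *\<^sub>C y))\<^sup>2" by simp
  ultimately have "(cmod (cinner x y))\<^sup>2 / (norm y)\<^sup>2 \<le> (norm x)\<^sup>2"
    unfolding norm_diff_squared e by simp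
  then have "(cmod (cinner x y))\<^sup>2 \<le> (norm x * norm y)\<^sup>2"
    using n by (simp add: pos_divide_le_eq power_mult_distrib)
  then show ?thesis by (rule power2_le_imp_le) simp
qed simp

lemma cinner_eqI:
  assumes "\<And>x. cinner x y = cinner x (z :: 'a :: chilbert_space)"
  shows "y = z"
proof -
  have "cinner (y - z) (y - z) = 0"
    using assms[of "y - z"] by (simp add: cinner_diff_right)
  then show ?thesis by (simp add: cinner_self)
qed

lemma tendsto_cinner:
  assumes "(f \<longlongrightarrow> l) F"
  shows "((\<lambda>n. cinner x (f n)) \<longlongrightarrow> cinner x (l :: 'a :: chilbert_space)) F"
proof -
  have "bounded_linear (cinner x)"
    by (rule bounded_linear_intro[where K = "norm x"])
      (simp_all add: cinner_linear scaleR_conv_of_real cinner_cauchy_schwarz mult.commute[of _ "norm x"])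
  then show ?thesis using assms by (rule bounded_linear.tendsto)
qed

section \<open>Orthogonal projections and adjoints\<close>

lemma orthogonal_decomposition:
  fixes K :: "'a :: chilbert_space set"
  assumes "closed K" "K \<noteq> {}"
    and add: "\<And>x y. x \<in> K \<Longrightarrow> y \<in> K \<Longrightarrow> x + y \<in> K"
    and scale: "\<And>c x. x \<in> K \<Longrightarrow> c *\<^sub>C x \<in> K"
  shows "\<exists>k\<in>K. \<forall>y\<in>K. cinner (x - k) y = 0"
proof -
  define d where "d = infdist x K"
  have d_le: "d \<le> norm (x - k)" if "k \<in> K" for k
    using infdist_le[OF that, of x] by (simp add: d_def dist_norm)
  have d0: "d \<ge> 0" by (simp add: d_def infdist_nonneg)
  have "\<exists>k\<in>K. norm (x - k) < d + inverse (real (Suc n))" for n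
  proof -
    have "infdist x K < d + inverse (real (Suc n))" by (simp add: d_def)
    then show ?thesis
      using cInf_lessD[of "(\<lambda>k. norm (x - k)) ` K"] \<open>K \<noteq> {}\<close>
      by (auto simp: infdist_notempty dist_norm)
  qed
  then obtain k where k: "\<And>n. k n \<in> K" "\<And>n. norm (x - k n) < d + inverse (real (Suc n))"
    by metis
  have lim_d: "(\<lambda>n. norm (x - k n)) \<longlonglongrightarrow> d"
  proof (rule tendsto_sandwich)
    show "(\<lambda>n. d) \<longlonglongrightarrow> d" by simp
    show "(\<lambda>n. d + inverse (real (Suc n))) \<longlonglongrightarrow> d"
      using tendsto_add[OF tendsto_const LIMSEQ_inverse_real_of_nat, of d] by simp
  qed (auto intro!: always_eventually d_le less_imp_le[OF k(2)] k(1) simp del: of_nat_Suc)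
  have close: "(norm (k m - k n))\<^sup>2 \<le> 2 * (norm (x - k m))\<^sup>2 + 2 * (norm (x - k n))\<^sup>2 - 4 * d\<^sup>2" for m n
  proof -
    let ?h = "(1/2) *\<^sub>R (k m + k n)"
    have "?h \<in> K" using add scale k by (simp add: scaleR_scaleC)
    then have "d\<^sup>2 \<le> (norm (x - ?h))\<^sup>2" using d_le d0 by (intro power_mono) auto
    moreover have "(x - k m) + (x - k n) = 2 *\<^sub>R (x - ?h)"
      by (simp add: scaleR_diff_right scaleR_2)
    moreover have "norm ((x - k m) - (x - k n)) = norm (k m - k n)"
      by (simp add: norm_minus_commute)
    ultimately show ?thesis
      using parallelogram[of "x - k m" "x - k n"] by (simp add: power_mult_distrib)
  qed
  have "Cauchy k"
  proof (rule metric_CauchyI)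
    fix e :: real assume "e > 0"
    have "(\<lambda>n. (norm (x - k n))\<^sup>2) \<longlonglongrightarrow> d\<^sup>2" by (intro tendsto_intros lim_d)
    moreover have "d\<^sup>2 < d\<^sup>2 + e\<^sup>2 / 4" using \<open>e > 0\<close> by simp
    ultimately obtain M where M: "\<And>n. n \<ge> M \<Longrightarrow> (norm (x - k n))\<^sup>2 < d\<^sup>2 + e\<^sup>2 / 4"
      using order_tendstoD(2) eventually_sequentially by (metis (no_types, lifting))
    have "dist (k m) (k n) < e" if "m \<ge> M" "n \<ge> M" for m n
    proof -
      have "(norm (k m - k n))\<^sup>2 < e\<^sup>2" using close[of m n] M[of m] M[of n] that by linarith
      then show ?thesis using \<open>e > 0\<close> by (simp add: dist_norm power2_less_imp_less)
    qed
    then show "\<exists>M. \<forall>m\<ge>M. \<forall>n\<ge>M. dist (k m) (k n) < e" by blast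
  qed
  then obtain l where l: "k \<longlonglongrightarrow> l" using Cauchy_convergent convergent_def by blast
  have "l \<in> K" using closed_sequentially[OF \<open>closed K\<close> _ l] k by auto
  have "norm (x - l) = d"
    by (rule LIMSEQ_unique[OF _ lim_d]) (intro tendsto_intros l)
  have "cinner (x - l) y = 0" if "y \<in> K" for y
  proof (cases "y = 0")
    case False
    define c where "c = cinner y (x - l) / of_real ((norm y)\<^sup>2)"
    have n: "(norm y)\<^sup>2 > 0" using False by simp
    let ?i = "(cmod (cinner (x - l) y))\<^sup>2 / (norm y)\<^sup>2"
    have e: "cinner (x - l) (c *\<^sub>C y) = of_real ?i"
      by (simp add: c_def cinner_scaleC_right cinner_commute[of y "x - l"]
          
          complex_norm_square mult.commute del: of_real_power)
    have "cmod c = cmod (cinner (x - l) y) / (norm y)\<^sup>2"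
      by (simp add: c_def norm_divide norm_power cinner_commute[of y "x - l"])
    then have nc: "(norm (c *\<^sub>C y))\<^sup>2 = ?i"
      using n by (simp add: norm_scaleC power_mult_distrib power_divide) (simp add: power2_eq_square power4_eq_xxxx)
    have "l + c *\<^sub>C y \<in> K" using add scale that \<open>l \<in> K\<close> by blast
    then have "d\<^sup>2 \<le> (norm ((x - l) - c *\<^sub>C y))\<^sup>2"
      using d_le d0 by (intro power_mono) (auto simp: diff_diff_add)
    then have "?i \<le> 0"
      unfolding norm_diff_squared e nc \<open>norm (x - l) = d\<close> by simp
    then show ?thesis using n by (simp add: divide_le_0_iff)
  qed simp
  then show ?thesis using \<open>l \<in> K\<close> by blast
qed

lemma riesz_representation:
  fixes f :: "'a :: chilbert_space \<Rightarrow> complex"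
  assumes "bounded_linear f" and fC: "\<And>c x. f (c *\<^sub>C x) = c * f x"
  shows "\<exists>z. \<forall>x. f x = cinner z x"
proof (cases "\<forall>x. f x = 0")
  case True
  then show ?thesis by (intro exI[of _ 0]) simp
next
  case False
  interpret bounded_linear f by fact
  define K where "K = {x. f x = 0}"
  have "closed K" unfolding K_def
    by (intro closed_Collect_eq continuous_intros linear_continuous_on assms)
  obtain z where "f z \<noteq> 0" using False by blast
  have "0 \<in> K" by (simp add: K_def zero)
  then have "K \<noteq> {}" by blast
  then obtain k where k: "k \<in> K" "\<And>y. y \<in> K \<Longrightarrow> cinner (z - k) y = 0"
    using orthogonal_decomposition[of K z] \<open>closed K\<close>
    by (auto simp: K_def add fC)
  define u where "u = z - k"
  have "f u \<noteq> 0" using k(1) \<open>f z \<noteq> 0\<close> by (simp add: u_def diff K_def)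
  then have "u \<noteq> 0" by (auto simp: zero)
  have "f x = cinner ((cnj (f u) / of_real ((norm u)\<^sup>2)) *\<^sub>C u) x" for x
  proof -
    have "cinner u (f u *\<^sub>C x - f x *\<^sub>C u) = 0"
      unfolding u_def by (rule k(2)) (simp add: K_def diff fC)
    then have "f u * cinner u x = f x * of_real ((norm u)\<^sup>2)"
      by (simp add: cinner_linear cinner_self)
    then show ?thesis using \<open>u \<noteq> 0\<close>
      by (simp add: cinner_linear field_simps)
  qed
  then show ?thesis by blast
qed

lemma adjoint_exists:
  fixes A :: "'h :: chilbert_space operator"
  assumes "A \<in> bounded_ops"
  shows "\<exists>B\<in>bounded_ops. \<forall>x y. cinner (blinfun_apply A x) y = cinner x (blinfun_apply B y)"
proof -
  have "\<exists>z. \<forall>x. cinner y (blinfun_apply A x) = cinner z x" for y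
  proof (rule riesz_representation)
    show "bounded_linear (\<lambda>x. cinner y (blinfun_apply A x))"
    proof (rule bounded_linear_intro[where K = "norm y * norm A"])
      show "norm (cinner y (blinfun_apply A x)) \<le> norm x * (norm y * norm A)" for x
        using order_trans[OF cinner_cauchy_schwarz[of y "blinfun_apply A x"]
            mult_left_mono[OF norm_blinfun[of A x] norm_ge_zero[of y]]]
        by (simp add: mult_ac)
    qed (simp_all add: blinfun.add_right blinfun.scaleR_right cinner_linear scaleR_conv_of_real)
  qed (use assms in \<open>simp add: bounded_ops_def cinner_linear\<close>)
  then obtain g where "\<And>x y. cinner y (blinfun_apply A x) = cinner (g y) x"
    by metis
  then have g: "cinner (blinfun_apply A x) y = cinner x (g y)" for x y
    by (metis cinner_commute)
  have bl: "bounded_linear g"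
  proof (rule bounded_linear_intro[where K = "norm A"])
    show "g (x + y) = g x + g y" for x y
      by (rule cinner_eqI) (simp add: cinner_linear g[symmetric])
    show "g (r *\<^sub>R x) = r *\<^sub>R g x" for r x
      by (rule cinner_eqI) (simp add: cinner_linear g[symmetric])
    show "norm (g y) \<le> norm y * norm A" for y
    proof -
      have "(norm (g y))\<^sup>2 = cmod (cinner (blinfun_apply A (g y)) y)"
        by (simp add: g cinner_self norm_power)
      also have "\<dots> \<le> norm A * norm (g y) * norm y"
        by (rule order_trans[OF cinner_cauchy_schwarz]) (simp add: mult_right_mono norm_blinfun)
      finally have "norm (g y) * norm (g y) \<le> norm (g y) * (norm y * norm A)"
        by (simp add: power2_eq_square mult_ac)
      then show ?thesis by (cases "norm (g y) = 0") (simp_all add: mult_le_cancel_left)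
    qed
  qed
  have "g (c *\<^sub>C x) = c *\<^sub>C g x" for c x
    by (rule cinner_eqI) (simp add: cinner_linear g[symmetric])
  then have "Blinfun g \<in> bounded_ops"
    by (simp add: bounded_ops_def bounded_linear_Blinfun_apply[OF bl])
  then show ?thesis
    by (rule bexI[rotated]) (simp add: bounded_linear_Blinfun_apply[OF bl] g)
qed

lemma adj_eqI:
  assumes "B \<in> bounded_ops" "\<And>x y. cinner (blinfun_apply A x) y = cinner x (blinfun_apply B y)"
  shows "adj A = B"
  unfolding adj_def
proof (rule the_equality)
  fix C assume "C \<in> bounded_ops \<and> (\<forall>x y. cinner (blinfun_apply A x) y = cinner x (blinfun_apply C y))"
  then show "C = B"
    by (intro blinfun_eqI cinner_eqI) (metis assms(2))
qed (use assms in blast)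

lemma
  assumes "A \<in> bounded_ops"
  shows adj_in_bounded_ops: "adj A \<in> bounded_ops"
    and cinner_adj_right: "cinner x (blinfun_apply (adj A) y) = cinner (blinfun_apply A x) y"
    and cinner_adj_left: "cinner (blinfun_apply (adj A) x) y = cinner x (blinfun_apply A y)"
proof -
  obtain B where "B \<in> bounded_ops" "adj A = B"
    "\<And>x y. cinner (blinfun_apply A x) y = cinner x (blinfun_apply B y)"
    using adjoint_exists[OF assms] by (metis adj_eqI)
  then show "adj A \<in> bounded_ops"
    and "cinner x (blinfun_apply (adj A) y) = cinner (blinfun_apply A x) y"
    and "cinner (blinfun_apply (adj A) x) y = cinner x (blinfun_apply A y)"
    by (auto, metis cinner_commute)
qed

section \<open>The algebra of bounded operators\<close>

lemmas compose_add_left = bounded_bilinear.add_left[OF bounded_bilinear_blinfun_compose]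
lemmas compose_add_right = bounded_bilinear.add_right[OF bounded_bilinear_blinfun_compose]
lemmas compose_diff_left = bounded_bilinear.diff_left[OF bounded_bilinear_blinfun_compose]
lemmas compose_diff_right = bounded_bilinear.diff_right[OF bounded_bilinear_blinfun_compose]
lemmas compose_scaleR_left = bounded_bilinear.scaleR_left[OF bounded_bilinear_blinfun_compose]
lemmas compose_scaleR_right = bounded_bilinear.scaleR_right[OF bounded_bilinear_blinfun_compose]
lemmas tendsto_compose_op = bounded_bilinear.tendsto[OF bounded_bilinear_blinfun_compose]

lemmas compose_linear =
  compose_add_left compose_add_right compose_diff_left compose_diff_right
  compose_scaleR_left compose_scaleR_right

lemma compose_assoc: "(A o\<^sub>L B) o\<^sub>L C = A o\<^sub>L (B o\<^sub>L C)"
  by (rule blinfun_eqI) simp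

lemma compose_id_left [simp]: "id_blinfun o\<^sub>L A = A"
  by (rule blinfun_eqI) simp

lemma compose_id_right [simp]: "A o\<^sub>L id_blinfun = A"
  by (rule blinfun_eqI) simp

lemma scaleC_blinfun_apply [simp]: "blinfun_apply (c *\<^sub>C A) x = c *\<^sub>C blinfun_apply (A :: 'h :: chilbert_space operator) x"
  by (simp add: scaleC_blinfun.rep_eq)

lemma compose_scaleC_left: "(c *\<^sub>C A) o\<^sub>L B = c *\<^sub>C ((A :: 'h :: chilbert_space operator) o\<^sub>L (B :: 'h operator))"
  by (rule blinfun_eqI) simp

lemma compose_scaleC_right: "A \<in> bounded_ops \<Longrightarrow> A o\<^sub>L (c *\<^sub>C (B :: 'h operator)) = c *\<^sub>C ((A :: 'h :: chilbert_space operator) o\<^sub>L B)"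
  by (rule blinfun_eqI) (simp add: bounded_ops_def)

lemma scaleR_scaleC_op: "r *\<^sub>R A = complex_of_real r *\<^sub>C (A :: 'h :: chilbert_space operator)"
  by (rule blinfun_eqI) (simp add: blinfun.scaleR_left scaleR_scaleC)

lemma scaleC_scaleC_op: "c *\<^sub>C d *\<^sub>C A = (c * d) *\<^sub>C (A :: 'h :: chilbert_space operator)"
  by (rule blinfun_eqI) (simp add: scaleC_scaleC)

lemma scaleC_zero_op [simp]: "c *\<^sub>C 0 = (0 :: 'h :: chilbert_space operator)"
  by (rule blinfun_eqI) simp

lemma scaleC_one_op [simp]: "1 *\<^sub>C A = (A :: 'h :: chilbert_space operator)"
  by (rule blinfun_eqI) simp

lemma scaleC_add_op: "c *\<^sub>C (A + B) = c *\<^sub>C A + c *\<^sub>C (B :: 'h :: chilbert_space operator)"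
  by (rule blinfun_eqI) (simp add: blinfun.add_left scaleC_add_right)

lemma scaleC_add_op_left: "(c + d) *\<^sub>C A = c *\<^sub>C A + d *\<^sub>C (A :: 'h :: chilbert_space operator)"
  by (rule blinfun_eqI) (simp add: blinfun.add_left scaleC_add_left)

lemma bounded_opsD: "A \<in> bounded_ops \<Longrightarrow> blinfun_apply A (c *\<^sub>C x) = c *\<^sub>C blinfun_apply A x"
  by (simp add: bounded_ops_def)

lemma bounded_ops_id: "id_blinfun \<in> bounded_ops"
  by (simp add: bounded_ops_def)

lemma bounded_ops_zero: "0 \<in> bounded_ops"
  by (simp add: bounded_ops_def)

lemma bounded_ops_add: "A \<in> bounded_ops \<Longrightarrow> B \<in> bounded_ops \<Longrightarrow> A + B \<in> bounded_ops"
  by (simp add: bounded_ops_def blinfun.add_left scaleC_add_right)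

lemma bounded_ops_diff: "A \<in> bounded_ops \<Longrightarrow> B \<in> bounded_ops \<Longrightarrow> A - B \<in> bounded_ops"
  by (simp add: bounded_ops_def blinfun.diff_left scaleC_diff_right)

lemma bounded_ops_scaleC: "A \<in> bounded_ops \<Longrightarrow> c *\<^sub>C A \<in> bounded_ops"
  by (simp add: bounded_ops_def scaleC_scaleC mult.commute)

lemma bounded_ops_scaleR: "A \<in> bounded_ops \<Longrightarrow> r *\<^sub>R A \<in> bounded_ops"
  by (simp add: scaleR_scaleC_op bounded_ops_scaleC)

lemma bounded_ops_compose: "A \<in> bounded_ops \<Longrightarrow> B \<in> bounded_ops \<Longrightarrow> A o\<^sub>L B \<in> bounded_ops"
  by (simp add: bounded_ops_def)

lemmas bounded_ops_intros =
  bounded_ops_id bounded_ops_zero bounded_ops_add bounded_ops_diff bounded_ops_scaleC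
  bounded_ops_scaleR bounded_ops_compose adj_in_bounded_ops

lemma tendsto_blinfun_apply:
  "(F \<longlongrightarrow> L) net \<Longrightarrow> ((\<lambda>n. blinfun_apply (F n) x) \<longlongrightarrow> blinfun_apply L x) net"
  by (intro tendsto_intros)

lemma bounded_ops_limit:
  assumes "\<And>n. F n \<in> bounded_ops" "F \<longlonglongrightarrow> L"
  shows "L \<in> bounded_ops"
  unfolding bounded_ops_def
proof (intro CollectI allI)
  fix c x
  have "(\<lambda>n. blinfun_apply (F n) (c *\<^sub>C x)) \<longlonglongrightarrow> c *\<^sub>C blinfun_apply L x"
    by (simp add: bounded_opsD[OF assms(1)]
        bounded_linear.tendsto[OF bounded_linear_scaleC] tendsto_blinfun_apply assms(2))
  moreover have "(\<lambda>n. blinfun_apply (F n) (c *\<^sub>C x)) \<longlonglongrightarrow> blinfun_apply L (c *\<^sub>C x)"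
    by (rule tendsto_blinfun_apply[OF assms(2)])
  ultimately show "blinfun_apply L (c *\<^sub>C x) = c *\<^sub>C blinfun_apply L x"
    by (rule LIMSEQ_unique[symmetric])
qed

lemma adj_compose:
  "A \<in> bounded_ops \<Longrightarrow> B \<in> bounded_ops \<Longrightarrow> adj (A o\<^sub>L B) = adj B o\<^sub>L adj A"
  by (rule adj_eqI) (simp_all add: bounded_ops_intros cinner_adj_right)

lemma adj_add: "A \<in> bounded_ops \<Longrightarrow> B \<in> bounded_ops \<Longrightarrow> adj (A + B) = adj A + adj B"
  by (rule adj_eqI) (simp_all add: bounded_ops_intros cinner_adj_right blinfun.add_left cinner_linear)

lemma adj_diff: "A \<in> bounded_ops \<Longrightarrow> B \<in> bounded_ops \<Longrightarrow> adj (A - B) = adj A - adj B"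
  by (rule adj_eqI) (simp_all add: bounded_ops_intros cinner_adj_right blinfun.diff_left cinner_linear)

lemma adj_scaleC: "A \<in> bounded_ops \<Longrightarrow> adj (c *\<^sub>C A) = cnj c *\<^sub>C adj A"
  by (rule adj_eqI) (simp_all add: bounded_ops_intros cinner_adj_right cinner_linear)

lemma adj_adj: "A \<in> bounded_ops \<Longrightarrow> adj (adj A) = A"
  by (rule adj_eqI) (simp_all add: cinner_adj_left)

lemma adj_id [simp]: "adj id_blinfun = id_blinfun"
  by (rule adj_eqI) (simp_all add: bounded_ops_id)

section \<open>Self-adjoint and positive operators\<close>

lemma selfadjoint_op_iff:
  "selfadjoint_op A \<longleftrightarrow> A \<in> bounded_ops \<and>
     (\<forall>x y. cinner (blinfun_apply A x) y = cinner x (blinfun_apply A y))"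
  by (metis adj_eqI cinner_adj_right selfadjoint_op_def)

lemma selfadjoint_op_cinner:
  "selfadjoint_op A \<Longrightarrow> cinner (blinfun_apply A x) y = cinner x (blinfun_apply A y)"
  by (simp add: selfadjoint_op_iff)

lemma selfadjoint_op_bounded: "selfadjoint_op A \<Longrightarrow> A \<in> bounded_ops"
  by (simp add: selfadjoint_op_def)

lemma selfadjoint_op_diff: "selfadjoint_op A \<Longrightarrow> selfadjoint_op B \<Longrightarrow> selfadjoint_op (A - B)"
  by (simp add: selfadjoint_op_def bounded_ops_diff adj_diff)

lemma selfadjoint_op_add: "selfadjoint_op A \<Longrightarrow> selfadjoint_op B \<Longrightarrow> selfadjoint_op (A + B)"
  by (simp add: selfadjoint_op_def bounded_ops_add adj_add)

lemma selfadjoint_op_scaleR: "selfadjoint_op A \<Longrightarrow> selfadjoint_op (r *\<^sub>R A)"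
  by (simp add: selfadjoint_op_def scaleR_scaleC_op bounded_ops_scaleC adj_scaleC)

lemma selfadjoint_op_id: "selfadjoint_op id_blinfun"
  by (simp add: selfadjoint_op_def bounded_ops_id)

lemma selfadjoint_op_compose:
  "selfadjoint_op A \<Longrightarrow> selfadjoint_op B \<Longrightarrow> A o\<^sub>L B = B o\<^sub>L A \<Longrightarrow> selfadjoint_op (A o\<^sub>L B)"
  by (simp add: selfadjoint_op_def bounded_ops_compose adj_compose)

lemma selfadjoint_op_cinner_real:
  assumes "selfadjoint_op A"
  shows "cinner x (blinfun_apply A x) = of_real (Re (cinner x (blinfun_apply A x)))"
proof -
  have "cnj (cinner x (blinfun_apply A x)) = cinner x (blinfun_apply A x)"
    by (metis assms cinner_commute selfadjoint_op_cinner)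
  then show ?thesis by (metis Reals_cnj_iff of_real_Re)
qed

lemma positive_op_iff:
  "positive_op A \<longleftrightarrow> selfadjoint_op A \<and> (\<forall>x. 0 \<le> Re (cinner x (blinfun_apply A x)))"
proof
  assume pos: "positive_op A"
  then have b: "A \<in> bounded_ops" by (simp add: positive_op_def)
  define h where "h x y = cinner (blinfun_apply A x) y - cinner x (blinfun_apply A y)" for x y
  have h0: "h x x = 0" for x
  proof -
    have "cinner x (blinfun_apply A x) \<in> \<real>\<^sub>\<ge>\<^sub>0" using pos by (simp add: positive_op_def)
    then show ?thesis
      unfolding h_def by (metis Reals_cnj_iff cinner_commute diff_self nonneg_Reals_subset_Reals subsetD)
  qed
  have "h x y = 0" for x y
  proof -
    have "h x y + h y x = h (x + y) (x + y) - h x x - h y y"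
      by (simp add: h_def blinfun.add_right cinner_linear)
    moreover have "\<i> * h x y - \<i> * h y x = h (x + \<i> *\<^sub>C y) (x + \<i> *\<^sub>C y) - h x x - h y y"
      by (simp add: h_def blinfun.add_right cinner_linear bounded_opsD[OF b] algebra_simps)
    ultimately have "h x y + h y x = 0" "h x y - h y x = 0"
      by (simp_all add: h0 right_diff_distrib[symmetric])
    then show ?thesis by simp
  qed
  then have "selfadjoint_op A" by (simp add: selfadjoint_op_iff b h_def)
  then show "selfadjoint_op A \<and> (\<forall>x. 0 \<le> Re (cinner x (blinfun_apply A x)))"
    using pos by (auto simp: positive_op_def complex_nonneg_Reals_iff)
next
  assume "selfadjoint_op A \<and> (\<forall>x. 0 \<le> Re (cinner x (blinfun_apply A x)))"
  then show "positive_op A"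
    unfolding positive_op_def
    by (metis selfadjoint_op_bounded selfadjoint_op_cinner_real nonneg_Reals_of_real_iff)
qed

lemma selfadjoint_op_limit:
  assumes "\<And>n. selfadjoint_op (F n)" "F \<longlonglongrightarrow> L"
  shows "selfadjoint_op L"
  unfolding selfadjoint_op_iff
proof (intro conjI allI)
  show "L \<in> bounded_ops" using assms bounded_ops_limit selfadjoint_op_bounded by blast
  fix x y
  have "(\<lambda>n. cinner y (blinfun_apply (F n) x)) \<longlonglongrightarrow> cinner y (blinfun_apply L x)"
    by (intro tendsto_cinner tendsto_blinfun_apply assms)
  from tendsto_cnj[OF this]
  have "(\<lambda>n. cinner (blinfun_apply (F n) x) y) \<longlonglongrightarrow> cinner (blinfun_apply L x) y"
    by (simp flip: cinner_commute)
  moreover have "(\<lambda>n. cinner (blinfun_apply (F n) x) y) \<longlonglongrightarrow> cinner x (blinfun_apply L y)"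
    unfolding selfadjoint_op_cinner[OF assms(1)]
    by (intro tendsto_cinner tendsto_blinfun_apply assms)
  ultimately show "cinner (blinfun_apply L x) y = cinner x (blinfun_apply L y)"
    by (rule LIMSEQ_unique)
qed

lemma Re_cinner_le_norm:
  "\<bar>Re (cinner x (blinfun_apply A x))\<bar> \<le> norm A * (norm (x :: 'h :: chilbert_space))\<^sup>2"
proof -
  have "\<bar>Re (cinner x (blinfun_apply A x))\<bar> \<le> norm x * norm (blinfun_apply A x)"
    by (rule order_trans[OF abs_Re_le_cmod cinner_cauchy_schwarz])
  also have "\<dots> \<le> norm x * (norm A * norm x)"
    by (simp add: mult_left_mono norm_blinfun)
  finally show ?thesis by (simp add: power2_eq_square mult_ac)
qed

lemma positive_op_norm_minus:
  assumes "selfadjoint_op A" "norm A \<le> e"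
  shows "positive_op (e *\<^sub>R id_blinfun - A)" "positive_op (e *\<^sub>R id_blinfun + A)"
proof -
  have "\<bar>Re (cinner x (blinfun_apply A x))\<bar> \<le> e * (norm x)\<^sup>2" for x
    by (rule order_trans[OF Re_cinner_le_norm]) (simp add: assms mult_right_mono)
  then have *: "Re (cinner x (blinfun_apply A x)) \<le> e * (norm x)\<^sup>2"
    "0 \<le> e * (norm x)\<^sup>2 + Re (cinner x (blinfun_apply A x))" for x
    by (smt (verit))+
  show "positive_op (e *\<^sub>R id_blinfun - A)"
    using assms *(1)
    by (simp add: positive_op_iff selfadjoint_op_diff selfadjoint_op_scaleR selfadjoint_op_id
        blinfun.diff_left blinfun.scaleR_left cinner_linear cinner_self del: of_real_power)
  show "positive_op (e *\<^sub>R id_blinfun + A)"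
    using assms *(2)
    by (simp add: positive_op_iff selfadjoint_op_add selfadjoint_op_scaleR selfadjoint_op_id
        blinfun.add_left blinfun.scaleR_left cinner_linear cinner_self
        del: of_real_power)
qed

lemma positive_op_adj_compose:
  assumes "T \<in> bounded_ops"
  shows "positive_op (adj T o\<^sub>L T)"
  using assms
  by (simp add: positive_op_def bounded_ops_intros cinner_adj_right cinner_self_nonneg)

section \<open>Polynomials of operators\<close>

lemma poly_op_eq_sum:
  assumes "degree q \<le> n"
  shows "poly_op q A = (\<Sum>i\<le>n. coeff q i *\<^sub>R (((o\<^sub>L) A ^^ i) id_blinfun))"
  unfolding poly_op_def
  by (rule sum.mono_neutral_left) (use assms in \<open>auto simp: coeff_eq_0\<close>)

lemma poly_op_pCons: "poly_op (pCons a q) A = a *\<^sub>R id_blinfun + (A o\<^sub>L poly_op q A)"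
proof -
  have "poly_op (pCons a q) A =
      (\<Sum>i\<le>Suc (degree q). coeff (pCons a q) i *\<^sub>R (((o\<^sub>L) A ^^ i) id_blinfun))"
    by (rule poly_op_eq_sum) simp
  also have "\<dots> = a *\<^sub>R id_blinfun + (\<Sum>i\<le>degree q. A o\<^sub>L (coeff q i *\<^sub>R (((o\<^sub>L) A ^^ i) id_blinfun)))"
    by (simp add: sum.atMost_Suc_shift compose_scaleR_right del: sum.atMost_Suc)
  also have "\<dots> = a *\<^sub>R id_blinfun + (A o\<^sub>L poly_op q A)"
    by (simp add: poly_op_def bounded_bilinear.sum_right[OF bounded_bilinear_blinfun_compose])
  finally show ?thesis .
qed

lemma poly_op_0 [simp]: "poly_op 0 A = 0"
  by (simp add: poly_op_def)

lemma poly_op_add: "poly_op (p + q) A = poly_op p A + poly_op q A"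
proof -
  let ?n = "max (degree p) (degree q)"
  have "degree (p + q) \<le> ?n" by (rule degree_add_le_max)
  then show ?thesis
    by (simp add: poly_op_eq_sum[of _ ?n] scaleR_add_left sum.distrib)
qed

lemma poly_op_smult: "poly_op (smult c q) A = c *\<^sub>R poly_op q A"
  by (simp add: poly_op_eq_sum[OF degree_smult_le] poly_op_def scaleR_sum_right)

lemma poly_op_diff: "poly_op (p - q) A = poly_op p A - poly_op q A"
  using poly_op_add[of p "smult (-1) q" A] poly_op_smult[of "-1" q A] by simp

lemma poly_op_mult: "poly_op (p * q) A = poly_op p A o\<^sub>L poly_op q A"
  by (induction p) (simp_all add: poly_op_pCons poly_op_add poly_op_smult compose_linear compose_assoc)

lemma poly_op_pcompose: "poly_op (pcompose p q) A = poly_op p (poly_op q A)"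
  by (induction p) (simp_all add: pcompose_pCons poly_op_pCons poly_op_add poly_op_mult)

lemma poly_op_X [simp]: "poly_op [:0, 1:] A = A"
  by (simp add: poly_op_pCons)

lemma poly_op_const [simp]: "poly_op [:c:] A = c *\<^sub>R id_blinfun"
  by (simp add: poly_op_pCons)

lemma poly_op_commute:
  assumes "A o\<^sub>L B = B o\<^sub>L A"
  shows "poly_op q A o\<^sub>L B = B o\<^sub>L poly_op q A"
  by (induction q) (simp_all add: poly_op_pCons compose_linear compose_assoc, metis assms compose_assoc)

lemma poly_op_mem:
  assumes "0 \<in> S" "id_blinfun \<in> S" "A \<in> S"
    and "\<And>B C. B \<in> S \<Longrightarrow> C \<in> S \<Longrightarrow> B + C \<in> S" "\<And>B C. B \<in> S \<Longrightarrow> C \<in> S \<Longrightarrow> B o\<^sub>L C \<in> S"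
    and "\<And>r B. B \<in> S \<Longrightarrow> r *\<^sub>R B \<in> S"
  shows "poly_op q A \<in> S"
  by (induction q) (simp_all add: poly_op_pCons assms)

lemma selfadjoint_poly_op:
  assumes "selfadjoint_op A"
  shows "selfadjoint_op (poly_op q A)"
proof (induction q)
  case (pCons a q)
  then show ?case
    by (simp add: poly_op_pCons assms selfadjoint_op_add selfadjoint_op_scaleR selfadjoint_op_id
        selfadjoint_op_compose poly_op_commute[OF refl])
qed (simp add: selfadjoint_op_iff bounded_ops_zero)

definition cpoly_op :: "complex poly \<Rightarrow> 'h :: chilbert_space operator \<Rightarrow> 'h operator" where
  "cpoly_op r A = fold_coeffs (\<lambda>a B. a *\<^sub>C id_blinfun + (A o\<^sub>L B)) r 0"

lemma cpoly_op_0 [simp]: "cpoly_op 0 A = 0"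
  by (simp add: cpoly_op_def)

lemma cpoly_op_pCons: "cpoly_op (pCons a r) A = a *\<^sub>C id_blinfun + (A o\<^sub>L cpoly_op r A)"
proof (cases "a = 0 \<and> r = 0")
  case True
  then show ?thesis by (simp add: blinfun_eqI)
next
  case False
  then show ?thesis by (auto simp: cpoly_op_def)
qed

lemma cpoly_op_of_real: "cpoly_op (map_poly of_real q) A = poly_op q A"
  by (induction q) (simp_all add: map_poly_pCons cpoly_op_pCons poly_op_pCons scaleR_scaleC_op)

lemma cpoly_op_add: "cpoly_op (p + q) A = cpoly_op p A + cpoly_op q A"
  by (induction p q rule: poly_induct2)
    (simp_all add: cpoly_op_pCons compose_linear scaleC_add_op_left)

lemma cpoly_op_smult: "A \<in> bounded_ops \<Longrightarrow> cpoly_op (smult c q) A = c *\<^sub>C cpoly_op q A"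
  by (induction q)
    (simp_all add: cpoly_op_pCons compose_scaleC_right scaleC_add_op scaleC_scaleC_op)

lemma cpoly_op_linear_factor:
  assumes "A \<in> bounded_ops"
  shows "cpoly_op ([:- z, 1:] * r) A = (A o\<^sub>L cpoly_op r A) - z *\<^sub>C cpoly_op r A"
proof -
  have "[:- z, 1:] * r = smult (- z) r + pCons 0 r" by simp
  then show ?thesis
    by (simp only: cpoly_op_add cpoly_op_smult[OF assms] cpoly_op_pCons)
      (simp add: blinfun_eqI blinfun.bilinear_simps)
qed

lemma cpoly_op_bounded_below:
  fixes A :: "'h :: chilbert_space operator"
  assumes "A \<in> bounded_ops" "r \<noteq> 0"
    and "\<And>z. poly r z = 0 \<Longrightarrow> \<exists>d>0. \<forall>x. d * norm x \<le> norm (blinfun_apply A x - z *\<^sub>C x)"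
  shows "\<exists>d>0. \<forall>x. d * norm x \<le> norm (blinfun_apply (cpoly_op r A) x)"
  using assms(2,3)
proof (induction "degree r" arbitrary: r)
  case 0
  then obtain c where "r = [:c:]" "c \<noteq> 0" by (metis degree_eq_zeroE pCons_0_0)
  then show ?case by (intro exI[of _ "cmod c"]) (simp add: cpoly_op_pCons norm_scaleC)
next
  case (Suc n)
  then have "\<not> constant (poly r)" by (simp add: constant_degree)
  then obtain z where z: "poly r z = 0" using fundamental_theorem_of_algebra by blast
  then obtain s where s: "r = [:- z, 1:] * s" by (meson dvdE poly_eq_0_iff_dvd)
  then have "s \<noteq> 0" using Suc.prems by auto
  then have "degree r = Suc (degree s)" unfolding s by (subst degree_mult_eq) auto
  then have "n = degree s" using Suc.hyps(2) by simp
  then obtain d where d: "d > 0" "\<And>x. d * norm x \<le> norm (blinfun_apply (cpoly_op s A) x)"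
    using Suc.hyps(1)[OF _ \<open>s \<noteq> 0\<close>] Suc.prems(2) s by auto
  obtain e where e: "e > 0" "\<And>x. e * norm x \<le> norm (blinfun_apply A x - z *\<^sub>C x)"
    using Suc.prems(2)[OF z] by blast
  have "e * d * norm x \<le> norm (blinfun_apply (cpoly_op r A) x)" for x
  proof -
    have "e * d * norm x \<le> e * norm (blinfun_apply (cpoly_op s A) x)"
      using d e by (simp add: mult.assoc)
    also have "\<dots> \<le> norm (blinfun_apply (cpoly_op r A) x)"
      using e(2)[of "blinfun_apply (cpoly_op s A) x"]
      by (simp only: s cpoly_op_linear_factor[OF assms(1)]) (simp add: blinfun.diff_left)
    finally show ?thesis .
  qed
  then show ?case using d e by (intro exI[of _ "e * d"]) simp
qed

lemma positive_op_minus_bounded_below: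
  fixes A :: "'h :: chilbert_space operator"
  assumes A: "positive_op A" "norm A \<le> M" and z: "z \<notin> of_real ` {0..M}"
  shows "\<exists>d>0. \<forall>x. d * norm x \<le> norm (blinfun_apply A x - z *\<^sub>C x)"
proof -
  let ?K = "complex_of_real ` {0..M}"
  have "0 \<le> M" using norm_ge_zero A(2) by (rule order_trans)
  have "compact ?K" by (intro compact_continuous_image continuous_intros) simp
  then have "infdist z ?K > 0"
    using z \<open>0 \<le> M\<close> by (intro infdist_pos_not_in_closed compact_imp_closed) auto
  moreover have "infdist z ?K * norm x \<le> norm (blinfun_apply A x - z *\<^sub>C x)" for x
  proof (cases "x = 0")
    case False
    then have n: "norm x > 0" by simp
    define a where "a = Re (cinner x (blinfun_apply A x)) / (norm x)\<^sup>2"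
    have sa: "selfadjoint_op A" using A(1) by (simp add: positive_op_iff)
    have "a \<ge> 0" using A(1) by (simp add: a_def positive_op_iff)
    moreover have "Re (cinner x (blinfun_apply A x)) \<le> M * (norm x)\<^sup>2"
      using Re_cinner_le_norm[of x A] mult_right_mono[OF A(2), of "(norm x)\<^sup>2"] by simp
    then have "a \<le> M" using n by (simp add: a_def pos_divide_le_eq)
    ultimately have "infdist z ?K \<le> cmod (of_real a - z)"
      by (metis atLeastAtMost_iff dist_commute dist_norm imageI infdist_le)
    then have "infdist z ?K * (norm x)\<^sup>2 \<le> cmod (of_real a - z) * (norm x)\<^sup>2"
      by (simp add: mult_right_mono)
    also have "\<dots> = cmod ((of_real a - z) * of_real ((norm x)\<^sup>2))"
      by (simp add: norm_mult norm_power)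
    also have "(of_real a - z) * of_real ((norm x)\<^sup>2) = cinner x (blinfun_apply A x - z *\<^sub>C x)"
      using n selfadjoint_op_cinner_real[OF sa, of x]
      by (simp add: a_def left_diff_distrib cinner_linear cinner_self del: of_real_power)
    also have "cmod \<dots> \<le> norm x * norm (blinfun_apply A x - z *\<^sub>C x)"
      by (rule cinner_cauchy_schwarz)
    finally show ?thesis using n by (simp add: power2_eq_square mult_ac)
  qed simp
  ultimately show ?thesis by blast
qed

text \<open>If \<open>b = \<parallel>q(A)\<parallel>\<close> exceeded \<open>e\<close>, then \<open>q\<^sup>2 - b\<^sup>2\<close> would have no root in \<open>[0, M]\<close>, so all its
  linear factors over the complex numbers, and hence \<open>q(A)\<^sup>2 - b\<^sup>2\<close>, would be bounded below. But
  \<open>b\<^sup>2\<close> is an approximate eigenvalue of \<open>q(A)\<^sup>2\<close>.\<close>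

theorem norm_poly_op_le:
  fixes A :: "'h :: chilbert_space operator"
  assumes A: "positive_op A" "norm A \<le> M" and e: "\<And>t. t \<in> {0..M} \<Longrightarrow> \<bar>poly q t\<bar> \<le> e"
  shows "norm (poly_op q A) \<le> e"
proof (rule ccontr)
  define B where "B = poly_op q A"
  define b where "b = norm B"
  assume "\<not> norm (poly_op q A) \<le> e"
  then have "e < b" by (simp add: b_def B_def)
  have "0 \<le> M" using norm_ge_zero A(2) by (rule order_trans)
  then have "0 \<le> e" using order_trans[OF abs_ge_zero e, of 0] by simp
  then have "b > 0" using \<open>e < b\<close> by simp
  have sa: "selfadjoint_op B"
    unfolding B_def using A(1) by (intro selfadjoint_poly_op) (simp add: positive_op_iff)
  define r where "r = q * q - [:b\<^sup>2:]"
  define r' where "r' = map_poly complex_of_real r"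
  have r_nz: "poly r t \<noteq> 0" if "t \<in> {0..M}" for t
  proof -
    have "(poly q t)\<^sup>2 \<le> e\<^sup>2" using e[OF that] by (rule abs_le_square_iff[THEN iffD1, OF order_trans]) simp
    also have "\<dots> < b\<^sup>2" using \<open>e < b\<close> \<open>0 \<le> e\<close> by (simp add: power_strict_mono)
    finally show ?thesis by (simp add: r_def power2_eq_square)
  qed
  have poly_r': "poly r' (of_real t) = of_real (poly r t)" for t
    unfolding r'_def by (induction r) (simp_all add: map_poly_pCons)
  have "poly r' (of_real 0) \<noteq> 0" using r_nz[of 0] \<open>0 \<le> M\<close> by (simp add: poly_r' del: of_real_0)
  then have "r' \<noteq> 0" by auto
  have "\<exists>d>0. \<forall>x. d * norm x \<le> norm (blinfun_apply (cpoly_op r' A) x)"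
  proof (rule cpoly_op_bounded_below[OF _ \<open>r' \<noteq> 0\<close>])
    show "A \<in> bounded_ops" using A(1) by (simp add: positive_op_def)
    fix z assume "poly r' z = 0"
    then have "z \<notin> of_real ` {0..M}" using r_nz by (auto simp: poly_r')
    then show "\<exists>d>0. \<forall>x. d * norm x \<le> norm (blinfun_apply A x - z *\<^sub>C x)"
      by (rule positive_op_minus_bounded_below[OF A])
  qed
  moreover have "cpoly_op r' A = (B o\<^sub>L B) - b\<^sup>2 *\<^sub>R id_blinfun"
    by (simp add: r'_def cpoly_op_of_real r_def poly_op_diff poly_op_mult B_def)
  ultimately obtain d where d: "d > 0"
    "\<And>x. d * norm x \<le> norm (blinfun_apply B (blinfun_apply B x) - b\<^sup>2 *\<^sub>R x)"
    by (auto simp: blinfun.diff_left blinfun.scaleR_left)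
  have est: "b\<^sup>2 * (norm (blinfun_apply B x))\<^sup>2 \<le> (b ^ 4 - d\<^sup>2) * (norm x)\<^sup>2" for x
  proof -
    let ?y = "blinfun_apply B x"
    have "d\<^sup>2 * (norm x)\<^sup>2 = (d * norm x)\<^sup>2" by (simp add: power_mult_distrib)
    also have "\<dots> \<le> (norm (blinfun_apply B ?y - b\<^sup>2 *\<^sub>R x))\<^sup>2"
      using d by (intro power_mono) auto
    also have "\<dots> = (norm (blinfun_apply B ?y))\<^sup>2 - 2 * (b\<^sup>2 * (norm ?y)\<^sup>2) + (b\<^sup>2 * norm x)\<^sup>2"
      by (simp add: norm_diff_squared cinner_linear selfadjoint_op_cinner[OF sa] cinner_self
          del: of_real_power)
    also have "(norm (blinfun_apply B ?y))\<^sup>2 \<le> (b * norm ?y)\<^sup>2"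
      by (intro power_mono) (simp_all add: b_def norm_blinfun)
    finally show ?thesis by (simp add: algebra_simps power_mult_distrib flip: power_mult)
  qed
  define c where "c = (b ^ 4 - d\<^sup>2) / b\<^sup>2"
  have c: "(norm (blinfun_apply B x))\<^sup>2 \<le> c * (norm x)\<^sup>2" for x
    using est[of x] \<open>b > 0\<close> by (simp add: c_def field_simps)
  have "c < b\<^sup>2"
    using \<open>b > 0\<close> \<open>d > 0\<close> by (simp add: c_def pos_divide_less_eq flip: power_add)
  have "b \<le> sqrt (max c 0)"
    unfolding b_def
  proof (rule norm_blinfun_bound)
    fix x
    have "(norm (blinfun_apply B x))\<^sup>2 \<le> max c 0 * (norm x)\<^sup>2"
      by (rule order_trans[OF c]) (simp add: mult_right_mono)
    then show "norm (blinfun_apply B x) \<le> sqrt (max c 0) * norm x"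
      by (metis norm_ge_zero real_le_rsqrt real_sqrt_mult real_sqrt_unique)
  qed simp
  moreover have "sqrt (max c 0) < sqrt (b\<^sup>2)"
    using \<open>c < b\<^sup>2\<close> \<open>b > 0\<close> by (subst real_sqrt_less_iff) simp
  ultimately show False using \<open>b > 0\<close> by simp
qed

lemma weierstrass_poly:
  fixes f :: "real \<Rightarrow> real"
  assumes "continuous_on {a..b} f"
  obtains q :: "nat \<Rightarrow> real poly" where "uniform_limit {a..b} (\<lambda>n. poly (q n)) f sequentially"
proof -
  have "\<exists>q. \<forall>x\<in>{a..b}. \<bar>f x - poly q x\<bar> < inverse (real (Suc n))" for n
  proof -
    obtain g where g: "real_polynomial_function g"
      "\<And>x. x \<in> {a..b} \<Longrightarrow> \<bar>f x - g x\<bar> < inverse (real (Suc n))"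
      using Stone_Weierstrass_real_polynomial_function[of "{a..b}" f "inverse (real (Suc n))"] assms
      by auto
    obtain c m where "g = (\<lambda>x. \<Sum>i\<le>m. c i * x ^ i)"
      using g(1) real_polynomial_function_iff_sum by blast
    then have "g = poly (\<Sum>i\<le>m. monom (c i) i)"
      by (simp add: poly_sum poly_monom fun_eq_iff)
    then show ?thesis using g(2) by blast
  qed
  then obtain q where q: "\<And>n x. x \<in> {a..b} \<Longrightarrow> \<bar>f x - poly (q n) x\<bar> < inverse (real (Suc n))"
    by metis
  have "uniform_limit {a..b} (\<lambda>n. poly (q n)) f sequentially"
  proof (rule uniform_limitI)
    fix e :: real assume "e > 0"
    then obtain k where "inverse (real (Suc k)) < e" using reals_Archimedean by blast
    then have "dist (poly (q n) x) (f x) < e" if "n \<ge> k" "x \<in> {a..b}" for n x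
    proof -
      have "inverse (real (Suc n)) \<le> inverse (real (Suc k))"
        using that(1) by (intro le_imp_inverse_le) auto
      then show ?thesis
        using q[OF that(2), of n] \<open>inverse (real (Suc k)) < e\<close> unfolding dist_real_def by linarith
    qed
    then show "\<forall>\<^sub>F n in sequentially. \<forall>x\<in>{a..b}. dist (poly (q n) x) (f x) < e"
      unfolding eventually_sequentially by blast
  qed
  then show thesis by (rule that)
qed

section \<open>Continuous functional calculus\<close>

lemma poly_op_null_sequence:
  fixes A :: "'h :: chilbert_space operator"
  assumes A: "positive_op A" "norm A \<le> M"
    and q: "uniform_limit {0..M} (\<lambda>n. poly (q n)) (\<lambda>_. 0) sequentially"
  shows "(\<lambda>n. poly_op (q n) A) \<longlonglongrightarrow> 0"
proof (rule tendstoI)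
  fix e :: real assume "e > 0"
  then have "\<forall>\<^sub>F n in sequentially. \<forall>x\<in>{0..M}. dist (poly (q n) x) 0 < e / 2"
    by (intro uniform_limitD[OF q]) simp
  then show "\<forall>\<^sub>F n in sequentially. dist (poly_op (q n) A) 0 < e"
  proof eventually_elim
    case (elim n)
    then have "norm (poly_op (q n) A) \<le> e / 2"
      by (intro norm_poly_op_le[OF A]) (simp add: less_imp_le)
    then show ?case using \<open>e > 0\<close> by simp
  qed
qed

lemma poly_op_same_limit:
  fixes A :: "'h :: chilbert_space operator"
  assumes A: "positive_op A" "norm A \<le> M"
    and q: "uniform_limit {0..M} (\<lambda>n. poly (q n)) f sequentially"
    and r: "uniform_limit {0..M} (\<lambda>n. poly (r n)) f sequentially"
    and lim: "(\<lambda>n. poly_op (q n) A) \<longlonglongrightarrow> B"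
  shows "(\<lambda>n. poly_op (r n) A) \<longlonglongrightarrow> B"
proof -
  have "(\<lambda>n. poly_op (r n - q n) A) \<longlonglongrightarrow> 0"
    by (rule poly_op_null_sequence[OF A]) (use uniform_limit_minus[OF r q] in \<open>simp add: poly_diff[abs_def]\<close>)
  then have "(\<lambda>n. poly_op (r n - q n) A + poly_op (q n) A) \<longlonglongrightarrow> 0 + B"
    by (rule tendsto_add[OF _ lim])
  then show ?thesis by (simp add: poly_op_diff)
qed

text \<open>Uniformity in \<open>A\<close> is what allows passing to the limit under the integral over \<open>\<phi>\<close>
  in \<open>fourier_abs_powr_op\<close>.\<close>

lemma poly_op_uniform_bound:
  fixes A :: "'h :: chilbert_space operator"
  assumes A: "positive_op A" "norm A \<le> M"
    and q: "uniform_limit {0..M} (\<lambda>n. poly (q n)) f sequentially"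
    and lim: "(\<lambda>n. poly_op (q n) A) \<longlonglongrightarrow> B"
    and n: "\<And>x. x \<in> {0..M} \<Longrightarrow> \<bar>poly (q n) x - f x\<bar> \<le> e" and "e > 0"
  shows "norm (poly_op (q n) A - B) \<le> 2 * e"
proof (rule tendsto_upperbound)
  show "(\<lambda>m. norm (poly_op (q n) A - poly_op (q m) A)) \<longlonglongrightarrow> norm (poly_op (q n) A - B)"
    by (intro tendsto_intros lim)
  have "\<forall>\<^sub>F m in sequentially. \<forall>x\<in>{0..M}. dist (poly (q m) x) (f x) < e"
    using \<open>e > 0\<close> by (rule uniform_limitD[OF q])
  then show "\<forall>\<^sub>F m in sequentially. norm (poly_op (q n) A - poly_op (q m) A) \<le> 2 * e"
  proof eventually_elim
    case (elim m)
    have "\<bar>poly (q n - q m) x\<bar> \<le> 2 * e" if "x \<in> {0..M}" for x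
      using n[OF that] bspec[OF elim that] by (simp add: dist_real_def)
    then have "norm (poly_op (q n - q m) A) \<le> 2 * e"
      by (rule norm_poly_op_le[OF A])
    then show ?case by (simp add: poly_op_diff)
  qed
qed simp

lemma poly_op_convergent:
  fixes A :: "'h :: chilbert_space operator"
  assumes A: "positive_op A" "norm A \<le> M"
    and q: "uniform_limit {0..M} (\<lambda>n. poly (q n)) f sequentially"
  shows "\<exists>B. (\<lambda>n. poly_op (q n) A) \<longlonglongrightarrow> B"
proof -
  have "Cauchy (\<lambda>n. poly_op (q n) A)"
  proof (rule metric_CauchyI)
    fix e :: real assume "e > 0"
    then have "\<forall>\<^sub>F n in sequentially. \<forall>x\<in>{0..M}. dist (poly (q n) x) (f x) < e / 4"
      by (intro uniform_limitD[OF q]) simp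
    then obtain k where k: "\<And>n x. n \<ge> k \<Longrightarrow> x \<in> {0..M} \<Longrightarrow> \<bar>poly (q n) x - f x\<bar> < e / 4"
      unfolding eventually_sequentially dist_real_def by blast
    have "dist (poly_op (q m) A) (poly_op (q n) A) < e" if "m \<ge> k" "n \<ge> k" for m n
    proof -
      have "\<bar>poly (q m - q n) x\<bar> \<le> e / 2" if "x \<in> {0..M}" for x
        using k[OF \<open>m \<ge> k\<close> that] k[OF \<open>n \<ge> k\<close> that] unfolding poly_diff by linarith
      then have "norm (poly_op (q m - q n) A) \<le> e / 2"
        by (rule norm_poly_op_le[OF A])
      then show ?thesis using \<open>e > 0\<close> by (simp add: poly_op_diff dist_norm)
    qed
    then show "\<exists>k. \<forall>m\<ge>k. \<forall>n\<ge>k. dist (poly_op (q m) A) (poly_op (q n) A) < e" by blast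
  qed
  then show ?thesis by (simp add: Cauchy_convergent_iff convergent_def)
qed

lemma fun_calc_limit:
  fixes A :: "'h :: chilbert_space operator"
  assumes A: "positive_op A" "norm A \<le> M"
    and q: "uniform_limit {0..M} (\<lambda>n. poly (q n)) f sequentially"
  shows "(\<lambda>n. poly_op (q n) A) \<longlonglongrightarrow> fun_calc f A"
proof -
  have q': "uniform_limit {0..norm A} (\<lambda>n. poly (q n)) f sequentially"
    by (rule uniform_limit_on_subset[OF q]) (use A in auto)
  obtain B where B: "(\<lambda>n. poly_op (q n) A) \<longlonglongrightarrow> B"
    using poly_op_convergent[OF A q] by blast
  have "fun_calc f A = B"
    unfolding fun_calc_def
  proof (rule the_equality)
    show "\<forall>r. uniform_limit {0..norm A} (\<lambda>n. poly (r n)) f sequentially \<longrightarrow>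
        (\<lambda>n. poly_op (r n) A) \<longlonglongrightarrow> B"
      using poly_op_same_limit[OF A(1) order_refl q' _ B] by blast
  next
    fix C assume "\<forall>r. uniform_limit {0..norm A} (\<lambda>n. poly (r n)) f sequentially \<longrightarrow>
        (\<lambda>n. poly_op (r n) A) \<longlonglongrightarrow> C"
    then have "(\<lambda>n. poly_op (q n) A) \<longlonglongrightarrow> C" using q' by blast
    then show "C = B" using B by (rule LIMSEQ_unique)
  qed
  then show ?thesis using B by simp
qed

lemma positive_poly_op_limit:
  fixes A :: "'h :: chilbert_space operator"
  assumes A: "positive_op A" "norm A \<le> M"
    and q: "uniform_limit {0..M} (\<lambda>n. poly (q n)) f sequentially"
    and f: "\<And>x. x \<in> {0..M} \<Longrightarrow> 0 \<le> f x" "continuous_on {0..M} f"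
    and lim: "(\<lambda>n. poly_op (q n) A) \<longlonglongrightarrow> B"
  shows "positive_op B"
proof -
  have "continuous_on {0..M} (\<lambda>x. sqrt (f x))" by (intro continuous_intros f)
  then obtain r where r: "uniform_limit {0..M} (\<lambda>n. poly (r n)) (\<lambda>x. sqrt (f x)) sequentially"
    by (rule weierstrass_poly)
  obtain C where C: "(\<lambda>n. poly_op (r n) A) \<longlonglongrightarrow> C"
    using poly_op_convergent[OF A r] by blast
  have "bounded ((\<lambda>x. sqrt (f x)) ` {0..M})"
    by (intro compact_imp_bounded compact_continuous_image continuous_intros f) simp
  from uniform_lim_mult[OF r r this this]
  have "uniform_limit {0..M} (\<lambda>n x. poly (r n) x * poly (r n) x) (\<lambda>x. sqrt (f x) * sqrt (f x)) sequentially" .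
  also have "?this \<longleftrightarrow> uniform_limit {0..M} (\<lambda>n. poly (r n * r n)) f sequentially"
    by (rule uniform_limit_cong') (use f(1) in auto)
  finally have "(\<lambda>n. poly_op (r n * r n) A) \<longlonglongrightarrow> B"
    by (rule poly_op_same_limit[OF A q _ lim])
  moreover have "(\<lambda>n. poly_op (r n * r n) A) \<longlonglongrightarrow> (C o\<^sub>L C)"
    unfolding poly_op_mult by (intro tendsto_compose_op C)
  ultimately have "B = C o\<^sub>L C" by (rule LIMSEQ_unique)
  moreover have "selfadjoint_op C"
    using A(1) by (intro selfadjoint_op_limit[OF _ C] selfadjoint_poly_op) (simp add: positive_op_iff)
  ultimately show ?thesis
    using positive_op_adj_compose[of C] by (simp add: selfadjoint_op_def)
qed

section \<open>Square roots\<close>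

lemma positive_sqrt_norm_le:
  assumes "positive_op S" "S o\<^sub>L S = P" "norm P \<le> M"
  shows "norm S \<le> sqrt M"
proof (rule norm_blinfun_bound)
  have "0 \<le> M" using norm_ge_zero assms(3) by (rule order_trans)
  then show "0 \<le> sqrt M" by simp
  fix x
  have sa: "selfadjoint_op S" using assms(1) by (simp add: positive_op_iff)
  have "complex_of_real ((norm (blinfun_apply S x))\<^sup>2) = cinner x (blinfun_apply P x)"
    by (simp add: selfadjoint_op_cinner[OF sa] flip: cinner_self assms(2) del: of_real_power)
  then have "(norm (blinfun_apply S x))\<^sup>2 = Re (cinner x (blinfun_apply P x))"
    by (metis Re_complex_of_real)
  also have "\<dots> \<le> norm P * (norm x)\<^sup>2" using Re_cinner_le_norm[of x P] by simp
  also have "\<dots> \<le> M * (norm x)\<^sup>2" using assms(3) by (simp add: mult_right_mono)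
  finally have "(norm (blinfun_apply S x))\<^sup>2 \<le> (sqrt M * norm x)\<^sup>2"
    using \<open>0 \<le> M\<close> by (simp add: power_mult_distrib)
  then show "norm (blinfun_apply S x) \<le> sqrt M * norm x"
    by (rule power2_le_imp_le) (simp add: \<open>0 \<le> M\<close>)
qed

lemma uniform_limit_poly_square:
  assumes "uniform_limit {0..M} (\<lambda>n. poly (q n)) f sequentially" "0 \<le> M"
  shows "uniform_limit {0..sqrt M} (\<lambda>n. poly (pcompose (q n) [:0, 0, 1:])) (\<lambda>x. f (x\<^sup>2)) sequentially"
proof -
  have "x\<^sup>2 \<in> {0..M}" if "x \<in> {0..sqrt M}" for x
    using that power_mono[of x "sqrt M" 2] assms(2) by auto
  then have "uniform_limit {0..sqrt M} (\<lambda>n x. poly (q n) (x\<^sup>2)) (\<lambda>x. f (x\<^sup>2)) sequentially"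
    using uniform_limit_compose'[OF assms(1), of "\<lambda>x. x\<^sup>2" "{0..sqrt M}"] by auto
  then show ?thesis by (simp add: poly_pcompose[abs_def] power2_eq_square)
qed

lemma poly_op_square: "S o\<^sub>L S = P \<Longrightarrow> poly_op (pcompose q [:0, 0, 1:]) S = poly_op q P"
  by (simp add: poly_op_pcompose poly_op_pCons)

lemma positive_sqrt_limit:
  assumes S: "positive_op S" "S o\<^sub>L S = P" and M: "norm P \<le> M"
    and q: "uniform_limit {0..M} (\<lambda>n. poly (q n)) sqrt sequentially"
  shows "(\<lambda>n. poly_op (q n) P) \<longlonglongrightarrow> S"
proof -
  have "0 \<le> M" using norm_ge_zero M by (rule order_trans)
  have "uniform_limit {0..sqrt M} (\<lambda>n. poly (pcompose (q n) [:0, 0, 1:])) (\<lambda>x. sqrt (x\<^sup>2)) sequentially"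
    by (rule uniform_limit_poly_square[OF q \<open>0 \<le> M\<close>])
  also have "?this \<longleftrightarrow>
      uniform_limit {0..sqrt M} (\<lambda>n. poly (pcompose (q n) [:0, 0, 1:])) (poly [:0, 1:]) sequentially"
    by (rule uniform_limit_cong') auto
  finally have lim: "uniform_limit {0..sqrt M} (\<lambda>n. poly (pcompose (q n) [:0, 0, 1:])) (poly [:0, 1:]) sequentially" .
  have "(\<lambda>n. poly_op (pcompose (q n) [:0, 0, 1:]) S) \<longlonglongrightarrow> S"
    using poly_op_same_limit[OF S(1) positive_sqrt_norm_le[OF S M] _ lim, of "\<lambda>_. [:0, 1:]"]
    by (simp add: uniform_limit_const del: poly_pCons)
  then show ?thesis by (simp add: poly_op_square[OF S(2)])
qed

lemma positive_sqrt_ex1: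
  fixes P :: "'h :: chilbert_space operator"
  assumes P: "positive_op P"
  shows "\<exists>!S. positive_op S \<and> S o\<^sub>L S = P"
proof -
  have cont: "continuous_on {0..norm P} sqrt" by (intro continuous_intros)
  then obtain q where q: "uniform_limit {0..norm P} (\<lambda>n. poly (q n)) sqrt sequentially"
    by (rule weierstrass_poly)
  obtain S where S: "(\<lambda>n. poly_op (q n) P) \<longlonglongrightarrow> S"
    using poly_op_convergent[OF P order_refl q] by blast
  have "positive_op S"
    by (rule positive_poly_op_limit[OF P order_refl q _ cont S]) simp
  moreover have "S o\<^sub>L S = P"
  proof -
    have "bounded (sqrt ` {0..norm P})"
      by (intro compact_imp_bounded compact_continuous_image cont) simp
    from uniform_lim_mult[OF q q this this]
    have "uniform_limit {0..norm P} (\<lambda>n x. poly (q n) x * poly (q n) x) (\<lambda>x. sqrt x * sqrt x) sequentially" .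
    also have "?this \<longleftrightarrow> uniform_limit {0..norm P} (\<lambda>n. poly (q n * q n)) (poly [:0, 1:]) sequentially"
      by (rule uniform_limit_cong') auto
    finally have "(\<lambda>n. poly_op (q n * q n) P) \<longlonglongrightarrow> P"
      using poly_op_same_limit[OF P order_refl, of "\<lambda>_. [:0, 1:]" "poly [:0, 1:]"]
      by (simp add: uniform_limit_const del: poly_pCons)
    moreover have "(\<lambda>n. poly_op (q n * q n) P) \<longlonglongrightarrow> (S o\<^sub>L S)"
      unfolding poly_op_mult by (intro tendsto_compose_op S)
    ultimately show ?thesis by (rule LIMSEQ_unique[symmetric])
  qed
  moreover have "T = S" if "positive_op T" "T o\<^sub>L T = P" for T
    using positive_sqrt_limit[OF that order_refl q] S by (rule LIMSEQ_unique)
  ultimately show ?thesis by blast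
qed

lemma
  assumes "T \<in> bounded_ops"
  shows positive_abs_op: "positive_op (abs_op T)"
    and abs_op_squared: "abs_op T o\<^sub>L abs_op T = adj T o\<^sub>L T"
  using theI'[OF positive_sqrt_ex1[OF positive_op_adj_compose[OF assms]]]
  by (simp_all add: abs_op_def)

lemma abs_powr_op_limit:
  assumes T: "T \<in> bounded_ops" and "p > 0" and M: "norm (adj T o\<^sub>L T) \<le> M"
    and q: "uniform_limit {0..M} (\<lambda>n. poly (q n)) (\<lambda>t. t powr (p / 2)) sequentially"
  shows "(\<lambda>n. poly_op (q n) (adj T o\<^sub>L T)) \<longlonglongrightarrow> abs_powr_op T p"
proof -
  let ?q = "\<lambda>n. pcompose (q n) [:0, 0, 1:]"
  have "0 \<le> M" using norm_ge_zero M by (rule order_trans)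
  have "uniform_limit {0..sqrt M} (\<lambda>n. poly (?q n)) (\<lambda>x. (x\<^sup>2) powr (p / 2)) sequentially"
    by (rule uniform_limit_poly_square[OF q \<open>0 \<le> M\<close>])
  also have "?this \<longleftrightarrow> uniform_limit {0..sqrt M} (\<lambda>n. poly (?q n)) (\<lambda>x. x powr p) sequentially"
  proof (rule uniform_limit_cong')
    show "(x\<^sup>2) powr (p / 2) = x powr p" if "x \<in> {0..sqrt M}" for x
      using that by (cases "x = 0") (simp_all add: powr_powr flip: powr_numeral)
  qed auto
  finally have lim: "uniform_limit {0..sqrt M} (\<lambda>n. poly (?q n)) (\<lambda>x. x powr p) sequentially" .
  have "(\<lambda>n. poly_op (?q n) (abs_op T)) \<longlonglongrightarrow> abs_powr_op T p"
    unfolding abs_powr_op_def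
    by (rule fun_calc_limit[OF positive_abs_op[OF T]
          positive_sqrt_norm_le[OF positive_abs_op[OF T] abs_op_squared[OF T] M] lim])
  then show ?thesis by (simp add: poly_op_square[OF abs_op_squared[OF T]])
qed

lemma positive_abs_powr_op:
  assumes T: "T \<in> bounded_ops" and "p > 0"
  shows "positive_op (abs_powr_op T p)"
proof -
  let ?P = "adj T o\<^sub>L T"
  have "continuous_on {0..norm ?P} (\<lambda>t. t powr (p / 2))"
    by (intro continuous_on_powr' continuous_intros) (use \<open>p > 0\<close> in auto)
  then obtain q where q: "uniform_limit {0..norm ?P} (\<lambda>n. poly (q n)) (\<lambda>t. t powr (p / 2)) sequentially"
    by (rule weierstrass_poly)
  show ?thesis
    by (rule positive_poly_op_limit[OF positive_op_adj_compose[OF T] order_refl q _ _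
          abs_powr_op_limit[OF T \<open>p > 0\<close> order_refl q]]) (use \<open>continuous_on _ _\<close> in auto)
qed

section \<open>Von Neumann algebras\<close>

lemma commutantI:
  "\<lbrakk>B \<in> bounded_ops; \<And>A. A \<in> S \<Longrightarrow> A o\<^sub>L B = B o\<^sub>L A\<rbrakk> \<Longrightarrow> B \<in> commutant S"
  by (simp add: commutant_def)

lemma commutant_commute: "B \<in> commutant S \<Longrightarrow> A \<in> S \<Longrightarrow> A o\<^sub>L B = B o\<^sub>L A"
  by (simp add: commutant_def)

lemma commutant_bounded: "B \<in> commutant S \<Longrightarrow> B \<in> bounded_ops"
  by (simp add: commutant_def)

locale vn_algebra =
  fixes N :: "('h :: chilbert_space) operator set"
  assumes von_neumann: "von_neumann_algebra N"
begin

lemma bounded: "A \<in> N \<Longrightarrow> A \<in> bounded_ops"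
  using von_neumann by (auto simp: von_neumann_algebra_def)

lemma adj_closed: "A \<in> N \<Longrightarrow> adj A \<in> N"
  using von_neumann by (simp add: von_neumann_algebra_def)

lemma memI:
  "\<lbrakk>B \<in> bounded_ops; \<And>T. T \<in> commutant N \<Longrightarrow> T o\<^sub>L B = B o\<^sub>L T\<rbrakk> \<Longrightarrow> B \<in> N"
  using von_neumann by (metis commutantI von_neumann_algebra_def)

lemma zero_closed: "0 \<in> N"
  by (rule memI) (simp_all add: bounded_ops_zero)

lemma id_closed: "id_blinfun \<in> N"
  by (rule memI) (simp_all add: bounded_ops_id)

lemma add_closed: "A \<in> N \<Longrightarrow> B \<in> N \<Longrightarrow> A + B \<in> N"
  by (rule memI) (auto simp: bounded_ops_add bounded compose_linear commutant_commute)

lemma diff_closed: "A \<in> N \<Longrightarrow> B \<in> N \<Longrightarrow> A - B \<in> N"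
  by (rule memI) (auto simp: bounded_ops_diff bounded compose_linear commutant_commute)

lemma scaleC_closed: "A \<in> N \<Longrightarrow> c *\<^sub>C A \<in> N"
  by (rule memI)
    (auto simp: bounded_ops_scaleC bounded compose_scaleC_left compose_scaleC_right
      commutant_bounded commutant_commute)

lemma scaleR_closed: "A \<in> N \<Longrightarrow> r *\<^sub>R A \<in> N"
  by (simp add: scaleR_scaleC_op scaleC_closed)

lemma compose_closed:
  assumes "A \<in> N" "B \<in> N"
  shows "A o\<^sub>L B \<in> N"
proof (rule memI)
  fix T assume T: "T \<in> commutant N"
  show "T o\<^sub>L (A o\<^sub>L B) = (A o\<^sub>L B) o\<^sub>L T"
    by (metis T assms commutant_commute compose_assoc)
qed (simp add: assms bounded bounded_ops_compose)

lemma limit_closed: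
  assumes "\<And>n. F n \<in> N" "F \<longlonglongrightarrow> L"
  shows "L \<in> N"
proof (rule memI)
  show "L \<in> bounded_ops" using assms bounded bounded_ops_limit by blast
  fix T assume T: "T \<in> commutant N"
  have "(\<lambda>n. T o\<^sub>L F n) \<longlonglongrightarrow> (T o\<^sub>L L)" by (intro tendsto_compose_op assms tendsto_const)
  moreover have "(\<lambda>n. T o\<^sub>L F n) \<longlonglongrightarrow> (L o\<^sub>L T)"
    unfolding commutant_commute[OF T assms(1), symmetric]
    by (intro tendsto_compose_op assms tendsto_const)
  ultimately show "T o\<^sub>L L = L o\<^sub>L T" by (rule LIMSEQ_unique)
qed

lemmas closed_intros =
  adj_closed zero_closed id_closed add_closed diff_closed scaleC_closed scaleR_closed
  compose_closed

lemma poly_op_closed: "A \<in> N \<Longrightarrow> poly_op q A \<in> N"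
  by (rule poly_op_mem) (auto intro: closed_intros)

lemma adj_commutant:
  assumes T: "T \<in> commutant N"
  shows "adj T \<in> commutant N"
proof (rule commutantI)
  have b: "T \<in> bounded_ops" using T by (rule commutant_bounded)
  then show "adj T \<in> bounded_ops" by (rule adj_in_bounded_ops)
  fix A assume "A \<in> N"
  then have "adj (adj A o\<^sub>L T) = adj (T o\<^sub>L adj A)"
    using T adj_closed commutant_commute by metis
  then show "A o\<^sub>L adj T = adj T o\<^sub>L A"
    using \<open>A \<in> N\<close> b by (simp add: adj_compose adj_in_bounded_ops bounded adj_adj)
qed

lemma kernel_projection:
  assumes "B \<in> N"
  shows "\<exists>E\<in>N. projection_op E \<and> B o\<^sub>L E = 0 \<and>
    (\<forall>x. blinfun_apply B x = 0 \<longrightarrow> blinfun_apply E x = x)"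
proof -
  note b = bounded[OF assms]
  define K where "K = {x. blinfun_apply B x = 0}"
  have sub: "x + y \<in> K" "c *\<^sub>C x \<in> K" "x - y \<in> K" if "x \<in> K" "y \<in> K" for x y c
    using that by (simp_all add: K_def blinfun.add_right blinfun.diff_right bounded_opsD[OF b])
  have "closed K" unfolding K_def by (intro closed_Collect_eq continuous_intros)
  moreover have "K \<noteq> {}" by (auto simp: K_def intro: exI[of _ 0])
  ultimately have "\<exists>k\<in>K. \<forall>y\<in>K. cinner (x - k) y = 0" for x
    using sub by (intro orthogonal_decomposition) auto
  then obtain g where g: "\<And>x. g x \<in> K" "\<And>x y. y \<in> K \<Longrightarrow> cinner (x - g x) y = 0"
    by metis
  have gI: "g x = k" if "k \<in> K" "\<And>y. y \<in> K \<Longrightarrow> cinner (x - k) y = 0" for x k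
  proof -
    have "cinner (x - k) (k - g x) - cinner (x - g x) (k - g x) = 0"
      using that g sub(3) by simp
    then have "cinner (g x - k) (g x - k) = 0"
      by (simp add: cinner_linear algebra_simps)
    then show ?thesis by (simp add: cinner_self)
  qed
  have bl: "bounded_linear g"
  proof (rule bounded_linear_intro[where K = 1])
    show "g (x + y) = g x + g y" for x y
    proof (rule gI)
      show "cinner (x + y - (g x + g y)) z = 0" if "z \<in> K" for z
        using g(2)[OF that, of x] g(2)[OF that, of y] by (simp add: cinner_linear)
    qed (use g sub in auto)
    show "g (r *\<^sub>R x) = r *\<^sub>R g x" for r x
    proof (rule gI)
      show "cinner (r *\<^sub>R x - r *\<^sub>R g x) z = 0" if "z \<in> K" for z
        using g(2)[OF that, of x] by (simp add: cinner_linear)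
    qed (simp add: scaleR_scaleC sub(2)[OF g(1) g(1)])
    show "norm (g x) \<le> norm x * 1" for x
    proof -
      have "(norm (g x))\<^sup>2 = cmod (cinner x (g x))"
        using g(2)[OF g(1), of x x] by (simp add: cinner_linear cinner_self norm_power)
      also have "\<dots> \<le> norm x * norm (g x)" by (rule cinner_cauchy_schwarz)
      finally show ?thesis
        by (cases "norm (g x) = 0") (simp_all add: power2_eq_square)
    qed
  qed
  define E where "E = Blinfun g"
  have E: "blinfun_apply E = g" by (simp add: E_def bounded_linear_Blinfun_apply[OF bl])
  have sa: "cinner (g x) y = cinner x (g y)" for x y
  proof -
    have "cinner x (g y) = cinner (g x) (g y)"
      using g(2)[OF g(1), of x y] by (simp add: cinner_linear)
    moreover have "cinner y (g x) = cinner (g y) (g x)"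
      using g(2)[OF g(1), of y x] by (simp add: cinner_linear)
    ultimately show ?thesis by (metis cinner_commute)
  qed
  have "g (c *\<^sub>C x) = c *\<^sub>C g x" for c x
  proof (rule gI)
    show "cinner (c *\<^sub>C x - c *\<^sub>C g x) z = 0" if "z \<in> K" for z
      using g(2)[OF that, of x] by (simp add: cinner_linear)
  qed (rule sub(2)[OF g(1) g(1)])
  then have Eb: "E \<in> bounded_ops" by (simp add: bounded_ops_def E)
  have gK: "g x = x" if "x \<in> K" for x
    using that by (intro gI) auto
  have "projection_op E"
    unfolding projection_op_def selfadjoint_op_iff
    using Eb sa g(1) gK by (auto simp: E intro!: blinfun_eqI)
  moreover have "B o\<^sub>L E = 0"
    using g(1) by (intro blinfun_eqI) (simp add: E K_def)
  moreover have "E \<in> N"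
  proof (rule memI[OF Eb])
    fix T assume T: "T \<in> commutant N"
    have inv: "blinfun_apply R y \<in> K" if "R \<in> commutant N" "y \<in> K" for R y
    proof -
      have "blinfun_apply B (blinfun_apply R y) = blinfun_apply R (blinfun_apply B y)"
        using commutant_commute[OF that(1) assms] by (metis blinfun_apply_blinfun_compose)
      then show ?thesis using that(2) by (simp add: K_def)
    qed
    have "g (blinfun_apply T x) = blinfun_apply T (g x)" for x
    proof (rule gI)
      show "blinfun_apply T (g x) \<in> K" using inv[OF T] g(1) by blast
      fix y assume "y \<in> K"
      then have "blinfun_apply (adj T) y \<in> K" by (rule inv[OF adj_commutant[OF T]])
      from g(2)[OF this, of x] show "cinner (blinfun_apply T x - blinfun_apply T (g x)) y = 0"
        by (simp add: cinner_adj_right[OF commutant_bounded[OF T]] blinfun.diff_right)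
    qed
    then show "T o\<^sub>L E = E o\<^sub>L T" by (intro blinfun_eqI) (simp add: E)
  qed
  ultimately show ?thesis using gK by (auto simp: E K_def)
qed

lemma abs_op_closed_commute:
  assumes "T \<in> N"
  shows "abs_op T \<in> N"
    and "A o\<^sub>L (adj T o\<^sub>L T) = (adj T o\<^sub>L T) o\<^sub>L A \<Longrightarrow> abs_op T o\<^sub>L A = A o\<^sub>L abs_op T"
proof -
  note b = bounded[OF assms]
  let ?P = "adj T o\<^sub>L T"
  have "continuous_on {0..norm ?P} sqrt" by (intro continuous_intros)
  then obtain q where q: "uniform_limit {0..norm ?P} (\<lambda>n. poly (q n)) sqrt sequentially"
    by (rule weierstrass_poly)
  note lim = positive_sqrt_limit[OF positive_abs_op[OF b] abs_op_squared[OF b] order_refl q]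
  show "abs_op T \<in> N"
    by (rule limit_closed[OF poly_op_closed lim]) (simp add: assms closed_intros)
  assume c: "A o\<^sub>L ?P = ?P o\<^sub>L A"
  have "(\<lambda>n. poly_op (q n) ?P o\<^sub>L A) \<longlonglongrightarrow> (abs_op T o\<^sub>L A)"
    by (intro tendsto_compose_op lim tendsto_const)
  moreover have "(\<lambda>n. poly_op (q n) ?P o\<^sub>L A) \<longlonglongrightarrow> (A o\<^sub>L abs_op T)"
    unfolding poly_op_commute[OF c[symmetric]]
    by (intro tendsto_compose_op lim tendsto_const)
  ultimately show "abs_op T o\<^sub>L A = A o\<^sub>L abs_op T" by (rule LIMSEQ_unique)
qed

end

section \<open>Tracial states\<close>

locale tracial_vn_algebra = vn_algebra N for N :: "('h :: chilbert_space) operator set" +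
  fixes \<tau> :: "'h operator \<Rightarrow> complex"
  assumes tracial: "tracial_state N \<tau>"
begin

lemma trace_add: "A \<in> N \<Longrightarrow> B \<in> N \<Longrightarrow> \<tau> (A + B) = \<tau> A + \<tau> B"
  and trace_scaleC: "A \<in> N \<Longrightarrow> \<tau> (c *\<^sub>C A) = c * \<tau> A"
  and trace_positive: "A \<in> N \<Longrightarrow> positive_op A \<Longrightarrow> \<tau> A \<in> \<real>\<^sub>\<ge>\<^sub>0"
  and trace_id: "\<tau> id_blinfun = 1"
  and trace_commute: "A \<in> N \<Longrightarrow> B \<in> N \<Longrightarrow> \<tau> (A o\<^sub>L B) = \<tau> (B o\<^sub>L A)"
  using tracial by (simp_all add: tracial_state_def)

lemma trace_scaleR: "A \<in> N \<Longrightarrow> \<tau> (r *\<^sub>R A) = of_real r * \<tau> A"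
  by (simp add: scaleR_scaleC_op trace_scaleC)

lemma trace_diff: "A \<in> N \<Longrightarrow> B \<in> N \<Longrightarrow> \<tau> (A - B) = \<tau> A - \<tau> B"
  using trace_add[of A "(-1) *\<^sub>R B"] trace_scaleR[of B "-1"] scaleR_closed[of B "-1"] by simp

lemma trace_zero: "\<tau> 0 = 0"
  using trace_diff[of 0 0] by (simp add: zero_closed)

lemma trace_selfadjoint:
  assumes "A \<in> N" "selfadjoint_op A"
  shows "\<tau> A \<in> \<real>" "cmod (\<tau> A) \<le> norm A"
proof -
  let ?e = "norm A"
  note pos = positive_op_norm_minus[OF assms(2) order_refl]
  have "\<tau> (?e *\<^sub>R id_blinfun - A) \<in> \<real>\<^sub>\<ge>\<^sub>0" "\<tau> (?e *\<^sub>R id_blinfun + A) \<in> \<real>\<^sub>\<ge>\<^sub>0"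
    by (intro trace_positive pos closed_intros assms)+
  then have "of_real ?e - \<tau> A \<in> \<real>\<^sub>\<ge>\<^sub>0" "of_real ?e + \<tau> A \<in> \<real>\<^sub>\<ge>\<^sub>0"
    by (simp_all add: trace_diff trace_add trace_scaleR trace_id assms closed_intros)
  then have *: "Re (\<tau> A) \<le> ?e" "- ?e \<le> Re (\<tau> A)" "Im (\<tau> A) = 0"
    by (simp_all add: complex_nonneg_Reals_iff)
  then show "\<tau> A \<in> \<real>" by (simp add: complex_is_Real_iff)
  then show "cmod (\<tau> A) \<le> norm A" using * by (simp add: in_Reals_norm abs_le_iff)
qed

lemma trace_adj:
  assumes "A \<in> N"
  shows "\<tau> (adj A) = cnj (\<tau> A)"
proof -
  note b = bounded[OF assms]
  let ?H = "A + adj A" and ?K = "\<i> *\<^sub>C (A - adj A)"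
  have "selfadjoint_op ?H"
    by (simp add: selfadjoint_op_def bounded_ops_intros b adj_add adj_adj)
  then have "\<tau> ?H \<in> \<real>" by (intro trace_selfadjoint closed_intros assms)
  have "adj ?K = ?K"
    by (simp add: adj_scaleC adj_diff bounded_ops_intros b adj_adj)
      (simp add: blinfun_eqI blinfun.diff_left scaleC_diff_right)
  then have "selfadjoint_op ?K" by (simp add: selfadjoint_op_def bounded_ops_intros b)
  then have "\<tau> ?K \<in> \<real>" by (intro trace_selfadjoint closed_intros assms)
  from \<open>\<tau> ?H \<in> \<real>\<close> this show ?thesis
    by (simp add: trace_add trace_scaleC trace_diff closed_intros assms complex_is_Real_iff
        complex_eq_iff)
qed

text \<open>If \<open>E\<close> is the projection onto the kernel of \<open>|H| - H\<close>, then \<open>EH\<close> is the positive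
  part of \<open>H\<close>.\<close>

lemma selfadjoint_eq_0I:
  assumes faithful: "faithful_on N \<tau>"
    and H: "H \<in> N" "selfadjoint_op H"
    and orth: "\<And>E. E \<in> N \<Longrightarrow> projection_op E \<Longrightarrow> \<tau> (E o\<^sub>L H) = 0"
  shows "H = 0"
proof -
  define A where "A = abs_op H"
  note b = bounded[OF H(1)]
  have adjH: "adj H = H" using H(2) by (simp add: selfadjoint_op_def)
  have AN: "A \<in> N" and AH: "A o\<^sub>L H = H o\<^sub>L A"
    unfolding A_def by (auto intro!: abs_op_closed_commute H simp: adjH compose_assoc)
  have posA: "positive_op A" and AA: "A o\<^sub>L A = H o\<^sub>L H"
    using positive_abs_op[OF b] abs_op_squared[OF b] by (simp_all add: A_def adjH)
  have saA: "selfadjoint_op A" using posA by (simp add: positive_op_iff)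
  have "A - H \<in> N" by (intro closed_intros AN H)
  then obtain E where E: "E \<in> N" "projection_op E" "(A - H) o\<^sub>L E = 0"
    and E_fix: "\<And>x. blinfun_apply (A - H) x = 0 \<Longrightarrow> blinfun_apply E x = x"
    using kernel_projection by blast
  have saE: "selfadjoint_op E" using E(2) by (simp add: projection_op_def)
  let ?X = "A + H"
  have saX: "selfadjoint_op ?X" by (intro selfadjoint_op_add saA H)
  have "(A - H) o\<^sub>L ?X = 0" by (simp add: compose_linear AH AA)
  then have EX: "E o\<^sub>L ?X = ?X"
    by (intro blinfun_eqI) (metis E_fix blinfun_apply_blinfun_compose zero_blinfun.rep_eq)
  have "adj ((A - H) o\<^sub>L E) = 0" using E(3) by (simp add: adj_eqI bounded_ops_zero)
  then have "E o\<^sub>L (A - H) = 0"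
    using saA saE H(2) by (simp add: adj_compose adj_diff selfadjoint_op_def bounded_ops_diff)
  then have EA: "E o\<^sub>L A = E o\<^sub>L H" by (simp add: compose_linear)
  have X: "?X = 2 *\<^sub>R (E o\<^sub>L H)" using EX by (simp add: compose_linear EA scaleR_2)
  then have "?X = 2 *\<^sub>R (A o\<^sub>L E)"
  proof -
    have "?X = adj ?X" using saX by (simp add: selfadjoint_op_def)
    also have "\<dots> = adj (2 *\<^sub>R (E o\<^sub>L A))" using X EA by simp
    also have "\<dots> = 2 *\<^sub>R (A o\<^sub>L E)"
      using saA saE
      by (simp add: scaleR_scaleC_op adj_scaleC adj_compose selfadjoint_op_def bounded_ops_compose)
    finally show ?thesis .
  qed
  then have XE: "?X = 2 *\<^sub>R (E o\<^sub>L (A o\<^sub>L E))" using EX by (metis compose_scaleR_right)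
  have "positive_op ?X"
    unfolding positive_op_iff
  proof (intro conjI allI saX)
    fix x
    have "cinner x (blinfun_apply ?X x) =
        2 * cinner (blinfun_apply E x) (blinfun_apply A (blinfun_apply E x))"
      unfolding XE by (simp add: blinfun.scaleR_left cinner_linear selfadjoint_op_cinner[OF saE])
    then show "0 \<le> Re (cinner x (blinfun_apply ?X x))"
      using posA by (simp add: positive_op_iff)
  qed
  moreover have "?X \<in> N" by (intro closed_intros AN H)
  moreover have "\<tau> ?X = 0" unfolding X by (simp add: trace_scaleR closed_intros E H orth)
  ultimately have "?X = 0" using faithful by (simp add: faithful_on_def)
  have "\<tau> H = 0" using orth[OF id_closed] by (simp add: projection_op_def selfadjoint_op_id)
  then have "\<tau> A = 0" using \<open>\<tau> ?X = 0\<close> by (simp add: trace_add AN H)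
  then have "A = 0" using faithful posA AN by (simp add: faithful_on_def)
  then show ?thesis using \<open>?X = 0\<close> by simp
qed

lemma eq_0I_projections:
  assumes faithful: "faithful_on N \<tau>"
    and D: "D \<in> N" and orth: "\<And>E. E \<in> N \<Longrightarrow> projection_op E \<Longrightarrow> \<tau> (E o\<^sub>L D) = 0"
  shows "D = 0"
proof -
  note b = bounded[OF D]
  have orth': "\<tau> (E o\<^sub>L adj D) = 0" if E: "E \<in> N" "projection_op E" for E
  proof -
    have "E o\<^sub>L adj D = adj (D o\<^sub>L E)"
      using E by (simp add: adj_compose b projection_op_def selfadjoint_op_def)
    then have "\<tau> (E o\<^sub>L adj D) = cnj (\<tau> (E o\<^sub>L D))"
      by (simp add: trace_adj closed_intros D E trace_commute)
    then show ?thesis by (simp add: orth E)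
  qed
  let ?H = "D + adj D" and ?K = "\<i> *\<^sub>C (D - adj D)"
  have "?H = 0"
    by (rule selfadjoint_eq_0I[OF faithful])
      (auto intro!: closed_intros D
        simp: selfadjoint_op_def bounded_ops_intros b adj_add adj_adj compose_linear
          trace_add closed_intros D orth orth')
  have "adj ?K = ?K"
    by (simp add: adj_scaleC adj_diff bounded_ops_intros b adj_adj)
      (simp add: blinfun_eqI blinfun.diff_left scaleC_diff_right)
  then have "?K = 0"
    by (intro selfadjoint_eq_0I[OF faithful])
      (auto intro!: closed_intros D
        simp: selfadjoint_op_def bounded_ops_intros b compose_scaleC_right bounded compose_linear
          trace_scaleC trace_diff closed_intros D orth orth')
  then have "(- \<i>) *\<^sub>C ?K = 0" by simp
  then have "D - adj D = 0" by (simp add: scaleC_scaleC_op)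
  with \<open>?H = 0\<close> have "2 *\<^sub>R D = 0" by (simp add: scaleR_2)
  then show ?thesis by simp
qed

lemma eq_0I_symmetries:
  assumes faithful: "faithful_on N \<tau>" and D: "D \<in> N"
    and orth: "\<And>S. S \<in> unitary_group N \<Longrightarrow> selfadjoint_op S \<Longrightarrow> \<tau> (S o\<^sub>L D) = 0"
  shows "D = 0"
proof (rule eq_0I_projections[OF faithful D])
  fix E assume E: "E \<in> N" "projection_op E"
  have EE: "E o\<^sub>L E = E" and saE: "selfadjoint_op E" using E(2) by (simp_all add: projection_op_def)
  let ?S = "id_blinfun - 2 *\<^sub>R E"
  have sa: "selfadjoint_op ?S" by (intro selfadjoint_op_diff selfadjoint_op_id selfadjoint_op_scaleR saE)
  have "?S o\<^sub>L ?S = id_blinfun" by (simp add: scaleR_2 compose_linear EE)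
  then have "?S \<in> unitary_group N"
    using sa by (simp add: unitary_group_def unitary_op_def selfadjoint_op_def closed_intros E)
  then have "\<tau> (?S o\<^sub>L D) = 0" using sa by (rule orth)
  moreover have "\<tau> (id_blinfun o\<^sub>L D) = 0"
    by (rule orth) (simp_all add: unitary_group_def unitary_op_def id_closed bounded_ops_id selfadjoint_op_id)
  ultimately show "\<tau> (E o\<^sub>L D) = 0"
    by (simp add: compose_linear trace_diff trace_scaleR closed_intros D E)
qed

end

section \<open>The first Fourier coefficient of the distance curve\<close>

definition op_zpow :: "('h :: chilbert_space) operator \<Rightarrow> int \<Rightarrow> 'h operator" where
  "op_zpow X k = (if k \<ge> 0 then ((o\<^sub>L) X ^^ nat k) id_blinfun
                  else ((o\<^sub>L) (adj X) ^^ nat (- k)) id_blinfun)"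

lemma op_zpow_0 [simp]: "op_zpow X 0 = id_blinfun"
  by (simp add: op_zpow_def)

lemma op_zpow_1 [simp]: "op_zpow X 1 = X"
  by (simp add: op_zpow_def)

lemma op_zpow_minus: "X \<in> bounded_ops \<Longrightarrow> op_zpow (adj X) (- k) = op_zpow X k"
  by (cases "k = 0") (auto simp: op_zpow_def adj_adj)

lemma op_zpow_succ:
  assumes "X o\<^sub>L adj X = id_blinfun"
  shows "X o\<^sub>L op_zpow X k = op_zpow X (k + 1)"
proof (cases "k \<ge> 0")
  case True
  then show ?thesis by (simp add: op_zpow_def nat_add_distrib)
next
  case False
  define m where "m = nat (- k) - 1"
  have k: "k = - int (Suc m)" using False by (simp add: m_def)
  have "X o\<^sub>L op_zpow X k = (X o\<^sub>L adj X) o\<^sub>L ((o\<^sub>L) (adj X) ^^ m) id_blinfun"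
    by (simp add: op_zpow_def k compose_assoc nat_add_distrib)
  also have "\<dots> = op_zpow X (k + 1)" by (simp add: assms) (simp add: op_zpow_def k nat_add_distrib)
  finally show ?thesis .
qed

lemma op_zpow_pred:
  assumes "X \<in> bounded_ops" "adj X o\<^sub>L X = id_blinfun"
  shows "adj X o\<^sub>L op_zpow X k = op_zpow X (k - 1)"
  using op_zpow_succ[of "adj X" "- k"] op_zpow_minus[OF assms(1), of k]
    op_zpow_minus[OF assms(1), of "k - 1"] assms
  by (simp add: adj_adj)

lemma (in vn_algebra) op_zpow_closed: "X \<in> N \<Longrightarrow> op_zpow X k \<in> N"
proof -
  have "((o\<^sub>L) A ^^ n) id_blinfun \<in> N" if "A \<in> N" for A n
    using that by (induction n) (simp_all add: closed_intros)
  then show "X \<in> N \<Longrightarrow> op_zpow X k \<in> N" by (simp add: op_zpow_def adj_closed)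
qed

lemma has_integral_cis:
  assumes "m \<noteq> 0"
  shows "((\<lambda>t. cis (of_int m * t)) has_integral 0) {0..2 * pi}"
proof -
  let ?F = "\<lambda>t. cis (of_int m * t) / (\<i> * of_int m)"
  have "((\<lambda>t. cis (of_int m * t)) has_integral (?F (2 * pi) - ?F 0)) {0..2 * pi}"
  proof (rule fundamental_theorem_of_calculus)
    show "(?F has_vector_derivative cis (of_int m * t)) (at t within {0..2 * pi})" for t
    proof -
      have "((\<lambda>t. exp (\<i> * of_int m * of_real t) / (\<i> * of_int m)) has_vector_derivative
          exp (\<i> * of_int m * of_real t)) (at t within {0..2 * pi})"
        using assms
        by (auto intro!: derivative_eq_intros has_vector_derivative_real_field simp: field_simps)
      then show ?thesis by (simp add: cis_conv_exp mult.assoc)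
    qed
  qed simp
  moreover have "cis (of_int m * (2 * pi)) = 1"
    using cis_multiple_2pi[of "of_int m"] by (simp add: mult_ac)
  ultimately show ?thesis by simp
qed

definition chord_coeff :: "real \<Rightarrow> complex" where
  "chord_coeff p = integral {0..2 * pi} (\<lambda>t. cis t * of_real ((2 - 2 * cos t) powr (p / 2)))"

lemma continuous_on_chord_powr:
  assumes "p > 0"
  shows "continuous_on S (\<lambda>t :: real. (2 - 2 * cos t) powr (p / 2))"
  by (intro continuous_on_powr' continuous_intros) (use assms in auto)

lemma chord_coeff_nonzero:
  assumes "p > 0"
  shows "chord_coeff p \<noteq> 0"
proof
  assume k: "chord_coeff p = 0"
  let ?f = "\<lambda>t. (2 - 2 * cos t) powr (p / 2)"
  let ?c = "2 powr (p / 2)"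
  let ?h = "\<lambda>t. cos t * (?c - ?f t)"
  note cont = continuous_on_chord_powr[OF assms]
  have "((\<lambda>t. cis t * of_real (?f t)) has_integral chord_coeff p) {0..2 * pi}"
    unfolding chord_coeff_def
    by (intro integrable_integral integrable_continuous_interval continuous_intros cont)
  from has_integral_linear[OF this bounded_linear_Re]
  have 1: "((\<lambda>t. cos t * ?f t) has_integral 0) {0..2 * pi}"
    by (simp add: o_def k)
  have 2: "((\<lambda>t. cos t) has_integral 0) {0..2 * pi}"
    using has_integral_linear[OF has_integral_cis[of 1] bounded_linear_Re] by (simp add: o_def)
  have int: "(?h has_integral 0) {0..2 * pi}"
    using has_integral_diff[OF has_integral_mult_left[OF 2, of ?c] 1]
    by (simp add: right_diff_distrib)
  have nonneg: "0 \<le> ?h t" for t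
  proof (cases "cos t \<ge> 0")
    case True
    then have "?f t \<le> ?c" using assms by (intro powr_mono2) auto
    with True show ?thesis by simp
  next
    case False
    then have "?c \<le> ?f t" using assms by (intro powr_mono2) auto
    with False show ?thesis by (simp add: mult_nonpos_nonpos)
  qed
  have "continuous_on {0..2 * pi} ?h" by (intro continuous_intros cont)
  moreover have "integral {0..2 * pi} ?h = 0" using int by (rule integral_unique)
  ultimately have "\<forall>t\<in>{0..2 * pi}. ?h t = 0"
    using integral_eq_0_iff[of 0 "2 * pi" ?h] nonneg pi_gt_zero by auto
  then have "?h 0 = 0" by (rule bspec) simp
  then show False using assms by simp
qed

context tracial_vn_algebra
begin

context
  fixes X
  assumes X: "X \<in> unitary_group N"
begin

abbreviation distance_sq :: "real \<Rightarrow> 'h operator" where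
  "distance_sq \<phi> \<equiv> 2 *\<^sub>R id_blinfun - cis (- \<phi>) *\<^sub>C X - cis \<phi> *\<^sub>C adj X"

abbreviation rotated_zpow :: "int \<Rightarrow> real \<Rightarrow> 'h operator" where
  "rotated_zpow k \<phi> \<equiv> cis (- of_int k * \<phi>) *\<^sub>C op_zpow X k"

lemma unitary_facts:
  "X \<in> N" "X \<in> bounded_ops" "adj X o\<^sub>L X = id_blinfun" "X o\<^sub>L adj X = id_blinfun"
  using X by (simp_all add: unitary_group_def unitary_op_def)

lemma distance_sq_closed: "distance_sq \<phi> \<in> N"
  by (intro closed_intros unitary_facts)

lemma distance_sq_rotated_zpow:
  "distance_sq \<phi> o\<^sub>L rotated_zpow k \<phi> =
     2 *\<^sub>R rotated_zpow k \<phi> - rotated_zpow (k + 1) \<phi> - rotated_zpow (k - 1) \<phi>"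
proof -
  have "cis (- \<phi>) * cis (- of_int k * \<phi>) = cis (- of_int (k + 1) * \<phi>)"
    "cis \<phi> * cis (- of_int k * \<phi>) = cis (- of_int (k - 1) * \<phi>)"
    by (simp_all add: cis_mult algebra_simps)
  then show ?thesis
    by (simp only: compose_linear compose_id_left compose_scaleC_left compose_scaleC_right
        unitary_facts adj_in_bounded_ops op_zpow_succ op_zpow_pred scaleC_scaleC_op mult.commute)
qed

text \<open>Multiplication by \<open>distance_sq\<close> shifts \<open>k\<close> by at most one, so the factor \<open>rotated_zpow k\<close>
  makes an induction on \<open>q\<close> possible; only \<open>k = 0\<close> is needed in the end.\<close>

lemma fourier_poly_op:
  "\<exists>I. ((\<lambda>t. cis t * of_real (poly q (2 - 2 * cos t)) * cis (- of_int k * t)) has_integral I) {0..2 * pi} \<and>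
     ((\<lambda>\<phi>. cis \<phi> * \<tau> (poly_op q (distance_sq \<phi>) o\<^sub>L rotated_zpow k \<phi>)) has_integral I * \<tau> X) {0..2 * pi} \<and>
     continuous_on {0..2 * pi} (\<lambda>\<phi>. cis \<phi> * \<tau> (poly_op q (distance_sq \<phi>) o\<^sub>L rotated_zpow k \<phi>))"
proof (induction q arbitrary: k)
  case 0
  then show ?case by (intro exI[of _ 0]) (simp add: trace_zero)
next
  case (pCons a q)
  let ?s = "\<lambda>q k t. cis t * of_real (poly q (2 - 2 * cos t)) * cis (- of_int k * t)"
  let ?g = "\<lambda>q k \<phi>. cis \<phi> * \<tau> (poly_op q (distance_sq \<phi>) o\<^sub>L rotated_zpow k \<phi>)"
  let ?b = "\<lambda>t. cis (of_int (1 - k) * t)"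
  have cis_b: "cis t * cis (- of_int k * t) = ?b t" for t
    by (simp add: cis_mult algebra_simps)
  obtain J where J: "(?b has_integral J) {0..2 * pi}"
    "((\<lambda>t. ?b t * \<tau> (op_zpow X k)) has_integral J * \<tau> X) {0..2 * pi}"
  proof (cases "k = 1")
    case True
    have "(?b has_integral integral {0..2 * pi} ?b) {0..2 * pi}"
      by (intro integrable_integral integrable_continuous_interval continuous_intros)
    from this has_integral_mult_left[OF this, of "\<tau> X"] show ?thesis
      using that True by simp
  next
    case False
    then have "(?b has_integral 0) {0..2 * pi}" by (intro has_integral_cis) simp
    from this has_integral_mult_left[OF this, of "\<tau> (op_zpow X k)"] show ?thesis
      using that[of 0] by simp
  qed
  obtain I0 I1 I2 where
    I0: "(?s q k has_integral I0) {0..2 * pi}" "(?g q k has_integral I0 * \<tau> X) {0..2 * pi}"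
      "continuous_on {0..2 * pi} (?g q k)" and
    I1: "(?s q (k + 1) has_integral I1) {0..2 * pi}" "(?g q (k + 1) has_integral I1 * \<tau> X) {0..2 * pi}"
      "continuous_on {0..2 * pi} (?g q (k + 1))" and
    I2: "(?s q (k - 1) has_integral I2) {0..2 * pi}" "(?g q (k - 1) has_integral I2 * \<tau> X) {0..2 * pi}"
      "continuous_on {0..2 * pi} (?g q (k - 1))"
    using pCons.IH[of k] pCons.IH[of "k + 1"] pCons.IH[of "k - 1"] by blast
  have s: "?s (pCons a q) k t = of_real a * ?b t + 2 * ?s q k t - ?s q (k + 1) t - ?s q (k - 1) t" for t
  proof -
    let ?w = "cis (- of_int k * t)"
    have w: "cis (- of_int (k + 1) * t) = ?w * cis (- t)" "cis (- of_int (k - 1) * t) = ?w * cis t"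
      by (simp_all add: cis_mult algebra_simps)
    have "complex_of_real (2 - 2 * cos t) = 2 - cis t - cis (- t)"
      by (simp add: complex_eq_iff)
    then have e: "complex_of_real (poly (pCons a q) (2 - 2 * cos t)) =
        of_real a + (2 - cis t - cis (- t)) * of_real (poly q (2 - 2 * cos t))"
      by (simp only: poly_pCons of_real_add of_real_mult)
    show ?thesis
      unfolding w cis_b[symmetric] e by (simp add: algebra_simps)
  qed
  have g: "?g (pCons a q) k \<phi> =
      of_real a * (?b \<phi> * \<tau> (op_zpow X k)) + 2 * ?g q k \<phi> - ?g q (k + 1) \<phi> - ?g q (k - 1) \<phi>" for \<phi>
  proof -
    let ?P = "distance_sq \<phi>" and ?Q = "poly_op q (distance_sq \<phi>)"
    have QN: "?Q \<in> N" by (intro poly_op_closed distance_sq_closed)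
    have "poly_op (pCons a q) ?P o\<^sub>L rotated_zpow k \<phi> =
        a *\<^sub>R rotated_zpow k \<phi> + (?Q o\<^sub>L (?P o\<^sub>L rotated_zpow k \<phi>))"
      by (simp only: poly_op_pCons compose_add_left compose_scaleR_left compose_id_left
          poly_op_commute[OF refl, symmetric] compose_assoc)
    also have "\<dots> = a *\<^sub>R rotated_zpow k \<phi> + (2 *\<^sub>R (?Q o\<^sub>L rotated_zpow k \<phi>)
        - (?Q o\<^sub>L rotated_zpow (k + 1) \<phi>) - (?Q o\<^sub>L rotated_zpow (k - 1) \<phi>))"
      by (subst distance_sq_rotated_zpow) (simp only: compose_diff_right compose_scaleR_right)
    finally have "\<tau> (poly_op (pCons a q) ?P o\<^sub>L rotated_zpow k \<phi>) =
        of_real a * (cis (- of_int k * \<phi>) * \<tau> (op_zpow X k)) + (2 * \<tau> (?Q o\<^sub>L rotated_zpow k \<phi>)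
        - \<tau> (?Q o\<^sub>L rotated_zpow (k + 1) \<phi>) - \<tau> (?Q o\<^sub>L rotated_zpow (k - 1) \<phi>))"
      by (simp add: trace_add trace_diff trace_scaleR trace_scaleC op_zpow_closed unitary_facts
          closed_intros QN del: of_int_add of_int_diff of_int_minus)
    then show ?thesis unfolding cis_b[symmetric] by (simp only:) (simp add: algebra_simps)
  qed
  define I where "I = of_real a * J + 2 * I0 - I1 - I2"
  have "(?s (pCons a q) k has_integral I) {0..2 * pi}"
    unfolding s I_def by (intro has_integral_diff has_integral_add has_integral_mult_right I0 I1 I2 J)
  moreover have "(?g (pCons a q) k has_integral
      of_real a * (J * \<tau> X) + 2 * (I0 * \<tau> X) - I1 * \<tau> X - I2 * \<tau> X) {0..2 * pi}"
    unfolding g by (intro has_integral_diff has_integral_add has_integral_mult_right I0 I1 I2 J)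
  moreover have "continuous_on {0..2 * pi} (?g (pCons a q) k)"
    unfolding g by (intro continuous_intros I0 I1 I2)
  ultimately show ?case
    by (intro exI[of _ I]) (simp add: I_def algebra_simps)
qed


lemma norm_unitary_le: "norm X \<le> 1" "norm (adj X) \<le> 1"
proof -
  have *: "norm V \<le> 1" if "V \<in> bounded_ops" "adj V o\<^sub>L V = id_blinfun" for V :: "'h operator"
  proof (rule norm_blinfun_bound)
    fix x
    have "complex_of_real ((norm (blinfun_apply V x))\<^sup>2) = of_real ((norm x)\<^sup>2)"
      unfolding cinner_self[symmetric] cinner_adj_right[OF that(1), symmetric]
      by (metis blinfun_apply_blinfun_compose blinfun_apply_id_blinfun id_apply that(2))
    then have "(norm (blinfun_apply V x))\<^sup>2 = (norm x)\<^sup>2"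
      by (simp only: of_real_eq_iff)
    then show "norm (blinfun_apply V x) \<le> 1 * norm x" by simp
  qed simp
  show "norm X \<le> 1" "norm (adj X) \<le> 1"
    by (intro *; simp add: unitary_facts adj_in_bounded_ops adj_adj)+
qed

lemma norm_distance_sq_le: "norm (distance_sq \<phi>) \<le> 4"
proof -
  have *: "norm (c *\<^sub>C V) \<le> 1" if "cmod c = 1" "norm V \<le> 1" for c and V :: "'h operator"
  proof (rule norm_blinfun_bound)
    show "norm (blinfun_apply (c *\<^sub>C V) x) \<le> 1 * norm x" for x
      using norm_blinfun[of V x] mult_right_mono[OF that(2), of "norm x"] that(1)
      by (simp add: norm_scaleC)
  qed simp
  have "norm (2 *\<^sub>R id_blinfun :: 'h operator) \<le> 2" using norm_blinfun_id_le[where 'a = 'h] by simp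
  moreover have "norm (cis (- \<phi>) *\<^sub>C X) \<le> 1" "norm (cis \<phi> *\<^sub>C adj X) \<le> 1"
    by (intro * norm_unitary_le; simp)+
  ultimately show ?thesis
    using norm_triangle_ineq4[of "2 *\<^sub>R id_blinfun - cis (- \<phi>) *\<^sub>C X" "cis \<phi> *\<^sub>C adj X"]
      norm_triangle_ineq4[of "2 *\<^sub>R id_blinfun" "cis (- \<phi>) *\<^sub>C X"] by linarith
qed

end

lemma fourier_abs_powr_op:
  assumes "p > 0" and A: "A \<in> unitary_group N" and S: "S \<in> unitary_group N" "selfadjoint_op S"
  shows "((\<lambda>\<phi>. cis \<phi> * \<tau> (abs_powr_op (A - cis \<phi> *\<^sub>C S) p)) has_integral
    chord_coeff p * \<tau> (S o\<^sub>L A)) {0..2 * pi}"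
proof -
  let ?X = "S o\<^sub>L A" and ?T = "\<lambda>\<phi>. A - cis \<phi> *\<^sub>C S"
  have AN: "A \<in> N" and Ab: "A \<in> bounded_ops" and AA: "adj A o\<^sub>L A = id_blinfun" "A o\<^sub>L adj A = id_blinfun"
    and SN: "S \<in> N" and Sb: "S \<in> bounded_ops" and SS: "S o\<^sub>L S = id_blinfun" and adjS: "adj S = S"
    using A S by (auto simp: unitary_group_def unitary_op_def selfadjoint_op_def)
  have adjX: "adj ?X = adj A o\<^sub>L S" by (simp add: adj_compose Ab Sb adjS)
  have X: "?X \<in> unitary_group N"
    unfolding unitary_group_def unitary_op_def mem_Collect_eq adjX
    by (auto intro!: closed_intros AN SN bounded_ops_compose Ab Sb simp: compose_assoc)
      (metis AA SS compose_assoc compose_id_left)+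
  have P: "adj (?T \<phi>) o\<^sub>L ?T \<phi> = distance_sq ?X \<phi>" for \<phi>
  proof -
    have "adj (?T \<phi>) = adj A - cis (- \<phi>) *\<^sub>C S"
      by (simp add: adj_diff adj_scaleC Ab Sb adjS bounded_ops_scaleC cis_cnj)
    then have "adj (?T \<phi>) o\<^sub>L ?T \<phi> =
        id_blinfun - cis \<phi> *\<^sub>C (adj A o\<^sub>L S) - (cis (- \<phi>) *\<^sub>C (S o\<^sub>L A) - id_blinfun)"
      by (simp add: compose_diff_left compose_diff_right AA SS compose_scaleC_left
          compose_scaleC_right Ab Sb adj_in_bounded_ops scaleC_scaleC_op cis_mult)
    then show ?thesis by (simp add: adjX scaleR_2)
  qed
  have Tb: "?T \<phi> \<in> bounded_ops" for \<phi> by (intro bounded_ops_intros Ab Sb)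
  have M: "norm (adj (?T \<phi>) o\<^sub>L ?T \<phi>) \<le> 4" for \<phi> unfolding P by (rule norm_distance_sq_le[OF X])
  let ?f = "\<lambda>t :: real. t powr (p / 2)"
  have "continuous_on {0..4} ?f"
    by (intro continuous_on_powr' continuous_intros) (use \<open>p > 0\<close> in auto)
  then obtain q where q: "uniform_limit {0..4} (\<lambda>n. poly (q n)) ?f sequentially"
    by (rule weierstrass_poly)
  have lim: "(\<lambda>n. poly_op (q n) (distance_sq ?X \<phi>)) \<longlonglongrightarrow> abs_powr_op (?T \<phi>) p" for \<phi>
    using abs_powr_op_limit[OF Tb \<open>p > 0\<close> M q] unfolding P .
  have powr_closed: "abs_powr_op (?T \<phi>) p \<in> N" for \<phi>
    by (rule limit_closed[OF poly_op_closed lim]) (rule distance_sq_closed[OF X])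
  let ?g = "\<lambda>n \<phi>. cis \<phi> * \<tau> (poly_op (q n) (distance_sq ?X \<phi>))"
  let ?h = "\<lambda>\<phi>. cis \<phi> * \<tau> (abs_powr_op (?T \<phi>) p)"
  let ?s = "\<lambda>n t. cis t * of_real (poly (q n) (2 - 2 * cos t))"
  let ?k = "\<lambda>t. cis t * of_real ((2 - 2 * cos t) powr (p / 2))"
  have "\<forall>n. \<exists>I. (?s n has_integral I) {0..2 * pi} \<and> (?g n has_integral I * \<tau> ?X) {0..2 * pi} \<and>
      continuous_on {0..2 * pi} (?g n)"
    using fourier_poly_op[OF X, of _ 0] by simp
  from choice[OF this] obtain I where
    *: "\<forall>n. (?s n has_integral I n) {0..2 * pi} \<and> (?g n has_integral I n * \<tau> ?X) {0..2 * pi} \<and>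
      continuous_on {0..2 * pi} (?g n)"
    by (rule exE)
  have I: "(?s n has_integral I n) {0..2 * pi}" "(?g n has_integral I n * \<tau> ?X) {0..2 * pi}"
    "continuous_on {0..2 * pi} (?g n)" for n
    using spec[OF *, of n] by - (elim conjE, assumption)+
  have "uniform_limit {0..2 * pi} ?g ?h sequentially"
  proof (rule uniform_limitI)
    fix e :: real assume "e > 0"
    then have "\<forall>\<^sub>F n in sequentially. \<forall>x\<in>{0..4}. dist (poly (q n) x) (?f x) < e / 3"
      by (intro uniform_limitD[OF q]) simp
    then show "\<forall>\<^sub>F n in sequentially. \<forall>\<phi>\<in>{0..2 * pi}. dist (?g n \<phi>) (?h \<phi>) < e"
    proof (eventually_elim, intro ballI)
      fix n \<phi>
      assume n: "\<forall>x\<in>{0..4}. dist (poly (q n) x) (?f x) < e / 3"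
      let ?P = "distance_sq ?X \<phi>"
      have pos: "positive_op ?P" unfolding P[symmetric] by (rule positive_op_adj_compose[OF Tb])
      have "selfadjoint_op (poly_op (q n) ?P - abs_powr_op (?T \<phi>) p)"
        using pos positive_abs_powr_op[OF Tb \<open>p > 0\<close>]
        by (intro selfadjoint_op_diff[OF selfadjoint_poly_op]) (simp_all add: positive_op_iff)
      then have "cmod (\<tau> (poly_op (q n) ?P - abs_powr_op (?T \<phi>) p))
          \<le> norm (poly_op (q n) ?P - abs_powr_op (?T \<phi>) p)"
        by (rule trace_selfadjoint(2)[OF diff_closed[OF poly_op_closed[OF distance_sq_closed[OF X]]
                powr_closed]])
      also have "\<dots> \<le> 2 * (e / 3)"
        using n \<open>e > 0\<close>
        by (intro poly_op_uniform_bound[OF pos norm_distance_sq_le[OF X] q lim])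
          (auto simp: dist_real_def intro: less_imp_le)
      also have "\<dots> < e" using \<open>e > 0\<close> by simp
      finally have "cmod (\<tau> (poly_op (q n) ?P) - \<tau> (abs_powr_op (?T \<phi>) p)) < e"
        by (simp add: trace_diff poly_op_closed powr_closed distance_sq_closed[OF X])
      then show "dist (?g n \<phi>) (?h \<phi>) < e"
        by (simp add: dist_norm norm_mult flip: right_diff_distrib)
    qed
  qed
  from uniform_limit_integral[OF this I(3) sequentially_bot] obtain J I' where J:
    "\<And>n. (?g n has_integral I' n) {0..2 * pi}" "(?h has_integral J) {0..2 * pi}" "I' \<longlonglongrightarrow> J"
    by blast
  have "I' = (\<lambda>n. I n * \<tau> ?X)" using J(1) I(2) has_integral_unique by blast
  have "uniform_limit {0..2 * pi} ?s ?k sequentially"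
  proof (rule uniform_limitI)
    fix e :: real assume "e > 0"
    then have "\<forall>\<^sub>F n in sequentially. \<forall>x\<in>{0..4}. dist (poly (q n) x) (?f x) < e"
      by (rule uniform_limitD[OF q])
    then show "\<forall>\<^sub>F n in sequentially. \<forall>t\<in>{0..2 * pi}. dist (?s n t) (?k t) < e"
    proof (eventually_elim, intro ballI)
      fix n and t :: real assume "\<forall>x\<in>{0..4}. dist (poly (q n) x) (?f x) < e"
      moreover have "2 - 2 * cos t \<in> {0..4}" using cos_le_one[of t] cos_ge_minus_one[of t]
        unfolding atLeastAtMost_iff by linarith
      ultimately have "dist (poly (q n) (2 - 2 * cos t)) (?f (2 - 2 * cos t)) < e" by blast
      then show "dist (?s n t) (?k t) < e"
        by (simp add: dist_norm norm_mult flip: right_diff_distrib of_real_diff)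
    qed
  qed
  moreover have "continuous_on {0..2 * pi} (?s n)" for n by (intro continuous_intros)
  ultimately obtain K I'' where K:
    "\<And>n. (?s n has_integral I'' n) {0..2 * pi}" "(?k has_integral K) {0..2 * pi}" "I'' \<longlonglongrightarrow> K"
    using uniform_limit_integral[OF _ _ sequentially_bot] by blast
  have "I'' = I" using K(1) I(1) has_integral_unique by blast
  moreover have "K = chord_coeff p" unfolding chord_coeff_def using K(2) by (rule integral_unique[symmetric])
  ultimately have "(\<lambda>n. I n * \<tau> ?X) \<longlonglongrightarrow> chord_coeff p * \<tau> ?X"
    using K(3) by (intro tendsto_intros) simp
  then have "J = chord_coeff p * \<tau> ?X"
    using J(3) \<open>I' = _\<close> LIMSEQ_unique by blast
  then show ?thesis using J(2) by simp
qed

lemma unitary_eqI_distances: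
  assumes "p > 0" "faithful_on N \<tau>"
    and A: "A \<in> unitary_group N" and B: "B \<in> unitary_group N"
    and dist: "\<And>S \<phi>. S \<in> unitary_group N \<Longrightarrow> selfadjoint_op S \<Longrightarrow>
      trace_norm \<tau> p (A - cis \<phi> *\<^sub>C S) = trace_norm \<tau> p (B - cis \<phi> *\<^sub>C S)"
  shows "A = B"
proof -
  have AN: "A \<in> N" and BN: "B \<in> N" using A B by (simp_all add: unitary_group_def)
  have trace_powr: "\<tau> (abs_powr_op T p) = of_real (trace_norm \<tau> p T powr p)" if "T \<in> N" for T
  proof -
    have "\<tau> (abs_powr_op T p) \<in> \<real>\<^sub>\<ge>\<^sub>0"
    proof (rule trace_positive)
      show "positive_op (abs_powr_op T p)"
        using that \<open>p > 0\<close> by (intro positive_abs_powr_op bounded)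
      have "continuous_on {0..norm (adj T o\<^sub>L T)} (\<lambda>t. t powr (p / 2))"
        by (intro continuous_on_powr' continuous_intros) (use \<open>p > 0\<close> in auto)
      then obtain q where q: "uniform_limit {0..norm (adj T o\<^sub>L T)} (\<lambda>n. poly (q n))
          (\<lambda>t. t powr (p / 2)) sequentially"
        by (rule weierstrass_poly)
      show "abs_powr_op T p \<in> N"
        by (rule limit_closed[OF poly_op_closed
              abs_powr_op_limit[OF bounded[OF that] \<open>p > 0\<close> order_refl q]])
          (simp add: that closed_intros)
    qed
    then obtain r where "r \<ge> 0" "\<tau> (abs_powr_op T p) = of_real r"
      by (auto elim: nonneg_Reals_cases)
    then show ?thesis using \<open>p > 0\<close> by (simp add: trace_norm_def powr_powr)
  qed
  have "A - B = 0"
  proof (rule eq_0I_symmetries[OF assms(2)])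
    show "A - B \<in> N" by (intro closed_intros AN BN)
    fix S assume S: "S \<in> unitary_group N" "selfadjoint_op S"
    then have SN: "S \<in> N" by (simp add: unitary_group_def)
    have eq: "\<tau> (abs_powr_op (A - cis \<phi> *\<^sub>C S) p) = \<tau> (abs_powr_op (B - cis \<phi> *\<^sub>C S) p)" for \<phi>
      using dist[OF S] by (simp add: trace_powr closed_intros AN BN SN)
    have "chord_coeff p * \<tau> (S o\<^sub>L A) = chord_coeff p * \<tau> (S o\<^sub>L B)"
      using fourier_abs_powr_op[OF \<open>p > 0\<close> A S] fourier_abs_powr_op[OF \<open>p > 0\<close> B S]
      unfolding eq by (rule has_integral_unique)
    then show "\<tau> (S o\<^sub>L (A - B)) = 0"
      using chord_coeff_nonzero[OF \<open>p > 0\<close>]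
      by (simp add: compose_linear trace_diff closed_intros AN BN SN)
  qed
  then show ?thesis by simp
qed

end

lemma (in vn_algebra) unitary_group_compose:
  assumes "U \<in> unitary_group N" "V \<in> unitary_group N"
  shows "U o\<^sub>L V \<in> unitary_group N"
proof -
  have "(U o\<^sub>L V) o\<^sub>L (adj V o\<^sub>L adj U) = U o\<^sub>L ((V o\<^sub>L adj V) o\<^sub>L adj U)"
    "(adj V o\<^sub>L adj U) o\<^sub>L (U o\<^sub>L V) = adj V o\<^sub>L ((adj U o\<^sub>L U) o\<^sub>L V)"
    by (simp_all only: compose_assoc)
  then show ?thesis
    using assms
    by (simp add: unitary_group_def unitary_op_def adj_compose bounded_ops_compose compose_closed)
qed

lemma (in vn_algebra) unitary_group_scaleC:
  assumes "U \<in> unitary_group N" "cmod c = 1"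
  shows "c *\<^sub>C U \<in> unitary_group N"
proof -
  have "c * cnj c = 1" using complex_norm_square[of c] assms(2) by simp
  then show ?thesis
    using assms(1)
    by (simp add: unitary_group_def unitary_op_def adj_scaleC bounded_ops_scaleC scaleC_closed
        compose_scaleC_left compose_scaleC_right adj_in_bounded_ops scaleC_scaleC_op mult.commute)
qed

theorem lemma2p8:
  fixes N :: "('h :: chilbert_space) operator set"
    and \<tau> :: "'h operator \<Rightarrow> complex"
    and \<psi> :: "'h operator \<Rightarrow> 'h operator"
    and p :: real
  assumes "0 < p" and "p \<noteq> 2"
    and "II1_factor N"
    and "canonical_trace N \<tau>"
    and "Lp_isometry N \<tau> p \<psi>"
    and "\<psi> ` unitary_group N = unitary_group N"
    and "\<forall>U\<in>unitary_group N. \<forall>\<theta>::real. selfadjoint_op U \<longrightarrow> \<psi> (cis \<theta> *\<^sub>C U) = cis \<theta> *\<^sub>C U"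
  shows "\<forall>U\<in>unitary_group N. \<forall>V\<in>unitary_group N. \<forall>\<theta>::real.
    selfadjoint_op U \<and> selfadjoint_op V \<longrightarrow>
      \<psi> (cis \<theta> *\<^sub>C (U o\<^sub>L V)) = cis \<theta> *\<^sub>C (U o\<^sub>L V)"
proof (intro ballI allI impI)
  fix U V \<theta> assume UV: "U \<in> unitary_group N" "V \<in> unitary_group N"
  interpret tracial_vn_algebra N \<tau>
    using assms(3,4)
    by unfold_locales (simp_all add: II1_factor_def factor_def canonical_trace_def)
  let ?A = "cis \<theta> *\<^sub>C (U o\<^sub>L V)"
  have A: "?A \<in> unitary_group N"
    using UV by (intro unitary_group_scaleC unitary_group_compose) simp_all
  have "?A = \<psi> ?A"
  proof (rule unitary_eqI_distances[OF \<open>0 < p\<close> _ A])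
    show "faithful_on N \<tau>" using assms(4) by (simp add: canonical_trace_def)
    show "\<psi> ?A \<in> unitary_group N" using assms(5) A by (simp add: Lp_isometry_def)
    fix S and \<phi> :: real assume S: "S \<in> unitary_group N" "selfadjoint_op S"
    then have "cis \<phi> *\<^sub>C S \<in> unitary_group N" by (simp add: unitary_group_scaleC)
    then have "trace_norm \<tau> p (?A - cis \<phi> *\<^sub>C S) = trace_norm \<tau> p (\<psi> ?A - \<psi> (cis \<phi> *\<^sub>C S))"
      using assms(5) A unfolding Lp_isometry_def by blast
    then show "trace_norm \<tau> p (?A - cis \<phi> *\<^sub>C S) = trace_norm \<tau> p (\<psi> ?A - cis \<phi> *\<^sub>C S)"
      using assms(7) S by simp
  qed
  then show "\<psi> ?A = ?A" by (rule sym)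
qed

end
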